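(* For $\mathbb K=\mathbb R$, $\mathbb C$ or $\mathbb H$ and every $r>0$, $T_r\mathbb K\mathbf P^n=W_2(\mathbb K^{n+1})$; that is, the tangent sphere bundle $T_r\mathbb K\mathbf P^n$ is (naturally) diffeomorphic to the $\mathbb K$-projective Stiefel manifold $W_2(\mathbb K^{n+1})$.
   Context: Here $n\ge2$ for $\mathbb K=\mathbb R,\mathbb C$ and $n\ge1$ for $\mathbb K=\mathbb H$ (quaternions). $T_r\mathbb K\mathbf P^n$ is the bundle of tangent vectors of length $r$ for the standard symmetric Riemannian metric on $\mathbb K\mathbf P^n$. The Stiefel manifold $V_2(\mathbb K^{n+1})$ is the manifold of orthonormal $2$-frames in $\mathbb K^{n+1}$ with its standard inner product. The projective Stiefel manifold $W_2(\mathbb K^{n+1})$ is the quotient of $V_2(\mathbb K^{n+1})$ by the free action (scalar multiplication of both vectors of the frame) of the group $S$ of unit elements of $\mathbb K$ ($S=\mathbb S^0,\mathbb S^1,\mathbb S^3$ respectively). *)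

theory Defs
  imports "HOL-Analysis.Analysis"
begin

section \<open>The scalars: real numbers, complex numbers, quaternions\<close>

datatype quat = Quat (Q0: real) (Q1: real) (Q2: real) (Q3: real)

lemma quat_eq_iff: "x = y \<longleftrightarrow> Q0 x = Q0 y \<and> Q1 x = Q1 y \<and> Q2 x = Q2 y \<and> Q3 x = Q3 y"
  by (cases x; cases y) auto

instantiation quat :: real_vector
begin

definition "0 = Quat 0 0 0 0"
definition "x + y = Quat (Q0 x + Q0 y) (Q1 x + Q1 y) (Q2 x + Q2 y) (Q3 x + Q3 y)"
definition "- x = Quat (- Q0 x) (- Q1 x) (- Q2 x) (- Q3 x)"
definition "x - y = Quat (Q0 x - Q0 y) (Q1 x - Q1 y) (Q2 x - Q2 y) (Q3 x - Q3 y)"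
definition "a *\<^sub>R x = Quat (a * Q0 x) (a * Q1 x) (a * Q2 x) (a * Q3 x)"

instance
  by standard
    (auto simp: zero_quat_def plus_quat_def uminus_quat_def minus_quat_def scaleR_quat_def
      algebra_simps)

end

lemma quat_sel_add [simp]:
  "Q0 0 = 0" "Q1 0 = 0" "Q2 0 = 0" "Q3 0 = 0"
  "Q0 (x + y) = Q0 x + Q0 y" "Q1 (x + y) = Q1 x + Q1 y"
  "Q2 (x + y) = Q2 x + Q2 y" "Q3 (x + y) = Q3 x + Q3 y"
  "Q0 (- x) = - Q0 x" "Q1 (- x) = - Q1 x" "Q2 (- x) = - Q2 x" "Q3 (- x) = - Q3 x"
  "Q0 (x - y) = Q0 x - Q0 y" "Q1 (x - y) = Q1 x - Q1 y"
  "Q2 (x - y) = Q2 x - Q2 y" "Q3 (x - y) = Q3 x - Q3 y"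
  "Q0 (a *\<^sub>R x) = a * Q0 x" "Q1 (a *\<^sub>R x) = a * Q1 x"
  "Q2 (a *\<^sub>R x) = a * Q2 x" "Q3 (a *\<^sub>R x) = a * Q3 x"
  by (simp_all add: zero_quat_def plus_quat_def uminus_quat_def minus_quat_def scaleR_quat_def)

instantiation quat :: real_inner
begin

definition "x \<bullet> y = Q0 x * Q0 y + Q1 x * Q1 y + Q2 x * Q2 y + Q3 x * Q3 y"
definition "norm (x::quat) = sqrt (x \<bullet> x)"
definition "sgn (x::quat) = x /\<^sub>R norm x"
definition "dist (x::quat) y = norm (x - y)"
definition "(uniformity :: (quat \<times> quat) filter) = (INF e\<in>{0<..}. principal {(x, y). dist x y < e})"
definition "open (U :: quat set) \<longleftrightarrow> (\<forall>x\<in>U. eventually (\<lambda>(x', y). x' = x \<longrightarrow> y \<in> U) uniformity)"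

instance
proof
  fix x y z :: quat and r :: real and U :: "quat set"
  show "x \<bullet> y = y \<bullet> x" "(x + y) \<bullet> z = x \<bullet> z + y \<bullet> z" "(r *\<^sub>R x) \<bullet> y = r * (x \<bullet> y)" "0 \<le> x \<bullet> x"
    by (simp_all add: inner_quat_def algebra_simps)
  show "(x \<bullet> x = 0) = (x = 0)"
    by (simp add: inner_quat_def quat_eq_iff add_nonneg_eq_0_iff)
qed (rule norm_quat_def sgn_quat_def dist_quat_def uniformity_quat_def open_quat_def)+

end

instantiation quat :: euclidean_space
begin

definition "Basis = {Quat 1 0 0 0, Quat 0 1 0 0, Quat 0 0 1 0, Quat 0 0 0 1}"

instance
proof
  fix u v x :: quat
  show "(Basis :: quat set) \<noteq> {}" "finite (Basis :: quat set)"
    by (simp_all add: Basis_quat_def)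
  show "u \<bullet> v = (if u = v then 1 else 0)" if "u \<in> Basis" "v \<in> Basis"
    using that unfolding Basis_quat_def by (elim insertE emptyE) (simp_all add: inner_quat_def)
  show "(\<forall>u\<in>Basis. x \<bullet> u = 0) \<longleftrightarrow> x = 0"
    by (cases x) (simp add: Basis_quat_def inner_quat_def zero_quat_def)
qed

end

lemma DIM_quat [simp]: "DIM(quat) = 4"
  by (simp add: Basis_quat_def)

instantiation quat :: real_normed_div_algebra
begin

definition "1 = Quat 1 0 0 0"
definition "x * y =
  Quat (Q0 x * Q0 y - Q1 x * Q1 y - Q2 x * Q2 y - Q3 x * Q3 y)
       (Q0 x * Q1 y + Q1 x * Q0 y + Q2 x * Q3 y - Q3 x * Q2 y)
       (Q0 x * Q2 y - Q1 x * Q3 y + Q2 x * Q0 y + Q3 x * Q1 y)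
       (Q0 x * Q3 y + Q1 x * Q2 y - Q2 x * Q1 y + Q3 x * Q0 y)"
definition "inverse x = Quat (Q0 x) (- Q1 x) (- Q2 x) (- Q3 x) /\<^sub>R (norm x)\<^sup>2"
definition "(x::quat) div y = x * inverse y"

instance
proof
  fix x y z :: quat and a :: real
  show "x * y * z = x * (y * z)" "(x + y) * z = x * z + y * z" "x * (y + z) = x * y + x * z"
    "1 * x = x" "x * 1 = x"
    by (simp_all add: quat_eq_iff times_quat_def one_quat_def algebra_simps)
  show scaleL: "(a *\<^sub>R x) * y = a *\<^sub>R (x * y)" and scaleR: "x * (a *\<^sub>R y) = a *\<^sub>R (x * y)"
    for a and x y :: quat
    by (simp_all add: quat_eq_iff times_quat_def algebra_simps)
  show "(0::quat) \<noteq> 1"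
    by (simp add: quat_eq_iff one_quat_def)
  show "inverse x * x = 1" "x * inverse x = 1" if "x \<noteq> 0"
  proof -
    let ?c = "Quat (Q0 x) (- Q1 x) (- Q2 x) (- Q3 x)"
    have inv: "inverse x = ?c /\<^sub>R (x \<bullet> x)"
      by (simp add: inverse_quat_def norm_quat_def)
    have "?c * x = (x \<bullet> x) *\<^sub>R 1" "x * ?c = (x \<bullet> x) *\<^sub>R 1"
      by (simp_all add: quat_eq_iff times_quat_def one_quat_def inner_quat_def)
    with that show "inverse x * x = 1" "x * inverse x = 1"
      by (simp_all add: inv scaleL scaleR)
  qed
  show "x div y = x * inverse y" "inverse (0::quat) = 0"
    by (simp_all add: divide_quat_def inverse_quat_def quat_eq_iff norm_quat_def inner_quat_def)
  show "norm (x * y) = norm x * norm y"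
    unfolding norm_quat_def real_sqrt_mult [symmetric]
    by (rule arg_cong [where f = sqrt]) (simp add: inner_quat_def times_quat_def algebra_simps)
qed

end

class conj_div_algebra = real_normed_div_algebra + euclidean_space +
  fixes conjug :: "'a \<Rightarrow> 'a"
  assumes conjug_add: "conjug (x + y) = conjug x + conjug y"
    and conjug_mult: "conjug (x * y) = conjug y * conjug x"
    and conjug_plus_self: "conjug x + x = (2 * (x \<bullet> 1)) *\<^sub>R 1"
    and conjug_mult_self: "conjug x * x = (norm x)\<^sup>2 *\<^sub>R 1"

instantiation real :: conj_div_algebra
begin
definition "conjug (x::real) = x"
instance
  by standard (simp_all add: conjug_real_def power2_eq_square)
end

instantiation complex :: conj_div_algebra
begin
definition "conjug = cnj"
instance
proof
  fix x y :: complex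
  show "conjug (x + y) = conjug x + conjug y" "conjug (x * y) = conjug y * conjug x"
    by (simp_all add: conjug_complex_def)
  show "conjug x + x = (2 * (x \<bullet> 1)) *\<^sub>R 1"
    by (simp add: conjug_complex_def complex_eq_iff inner_complex_def)
  show "conjug x * x = (norm x)\<^sup>2 *\<^sub>R 1"
    by (simp add: conjug_complex_def complex_eq_iff cmod_power2)
      (simp add: power2_eq_square)
qed
end

instantiation quat :: conj_div_algebra
begin
definition "conjug x = Quat (Q0 x) (- Q1 x) (- Q2 x) (- Q3 x)"
instance
proof
  fix x y :: quat
  show "conjug (x + y) = conjug x + conjug y" "conjug (x * y) = conjug y * conjug x"
    by (simp_all add: conjug_quat_def quat_eq_iff times_quat_def)
  show "conjug x + x = (2 * (x \<bullet> 1)) *\<^sub>R 1"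
    by (simp add: conjug_quat_def quat_eq_iff inner_quat_def one_quat_def)
  show "conjug x * x = (norm x)\<^sup>2 *\<^sub>R 1"
    by (simp add: conjug_quat_def quat_eq_iff norm_quat_def inner_quat_def times_quat_def
        one_quat_def)
qed
end


section \<open>Smooth maps between subsets of Euclidean spaces\<close>

primrec Ck_on :: "nat \<Rightarrow> ('a::real_normed_vector \<Rightarrow> 'b::real_normed_vector) \<Rightarrow> 'a set \<Rightarrow> bool" where
  "Ck_on 0 f S \<longleftrightarrow> continuous_on S f"
| "Ck_on (Suc k) f S \<longleftrightarrow> (\<forall>x\<in>S. f differentiable (at x)) \<and>
     (\<forall>v. Ck_on k (\<lambda>x. frechet_derivative f (at x) v) S)"

text \<open>For an open set this is the usual notion \<open>C\<^sup>\<infinity>\<close>; on an arbitrary subset of a Euclidean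
  space a map is smooth if it extends locally to smooth maps on open sets.\<close>

definition smooth_on :: "'a::euclidean_space set \<Rightarrow> ('a \<Rightarrow> 'b::euclidean_space) \<Rightarrow> bool" where
  "smooth_on S f \<longleftrightarrow>
     (\<forall>x\<in>S. \<exists>T g. open T \<and> x \<in> T \<and> (\<forall>k. Ck_on k g T) \<and> (\<forall>y\<in>S \<inter> T. f y = g y))"


section \<open>Smooth manifolds given by charts\<close>

text \<open>A manifold is given by its points and an atlas. A chart \<open>(U, \<phi>)\<close> maps \<open>U\<close> bijectively to an
  open subset of a linear subspace of the Euclidean space \<open>'e\<close>; allowing subspaces means that no
  type of exactly the dimension of the manifold is needed. The topology is the one induced by
  the charts.\<close>

type_synonym ('p, 'e) chart = "'p set \<times> ('p \<Rightarrow> 'e)"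

record ('p, 'e) manifold =
  points :: "'p set"
  charts :: "('p, 'e) chart set"

definition coordinates :: "'p set \<Rightarrow> ('p \<Rightarrow> 'e::euclidean_space) \<Rightarrow> bool" where
  "coordinates U \<phi> \<longleftrightarrow> inj_on \<phi> U \<and> (\<exists>E. subspace E \<and> openin (top_of_set E) (\<phi> ` U))"

definition smooth_map ::
  "('p, 'e::euclidean_space) manifold \<Rightarrow> ('q, 'f::euclidean_space) manifold \<Rightarrow> ('p \<Rightarrow> 'q) \<Rightarrow> bool" where
  "smooth_map M N F \<longleftrightarrow> F ` points M \<subseteq> points N \<and>
     (\<forall>p\<in>points M. \<exists>(U, \<phi>)\<in>charts M. \<exists>(V, \<psi>)\<in>charts N. p \<in> U \<and> F p \<in> V \<and>
        openin (top_of_set (\<phi> ` U)) (\<phi> ` (U \<inter> F -` V)) \<and>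
        smooth_on (\<phi> ` (U \<inter> F -` V)) (\<psi> \<circ> F \<circ> inv_into U \<phi>))"

definition diffeomorphism ::
  "('p, 'e::euclidean_space) manifold \<Rightarrow> ('q, 'f::euclidean_space) manifold \<Rightarrow> ('p \<Rightarrow> 'q) \<Rightarrow> bool" where
  "diffeomorphism M N F \<longleftrightarrow> bij_betw F (points M) (points N) \<and>
     smooth_map M N F \<and> smooth_map N M (inv_into (points M) F)"

text \<open>The embedded submanifold \<open>N \<subseteq> M\<close>: its charts \<open>(V, \<psi>)\<close> are those which are, in terms of the
  charts of \<open>M\<close>, diffeomorphisms from an open subset of \<open>N\<close> onto their image.\<close>

definition submanifold ::
  "('p, 'e::euclidean_space) manifold \<Rightarrow> 'p set \<Rightarrow> ('p, 'e) manifold" where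
  "submanifold M N = \<lparr>points = N,
     charts = {(V, \<psi>). V \<subseteq> N \<and> coordinates V \<psi> \<and>
       (\<forall>(U, \<phi>)\<in>charts M.
          openin (top_of_set (\<phi> ` (N \<inter> U))) (\<phi> ` (V \<inter> U)) \<and>
          openin (top_of_set (\<psi> ` V)) (\<psi> ` (V \<inter> U)) \<and>
          smooth_on (\<phi> ` (V \<inter> U)) (\<psi> \<circ> inv_into U \<phi>) \<and>
          smooth_on (\<psi> ` (V \<inter> U)) (\<phi> \<circ> inv_into V \<psi>))}\<rparr>"

text \<open>The quotient manifold of a submanifold \<open>P\<close> of a Euclidean space along \<open>\<pi>\<close>: its charts
  \<open>(U, \<phi>)\<close> are those for which \<open>U\<close> is open in the quotient topology and \<open>\<phi> \<circ> \<pi>\<close> is a smooth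
  submersion, i.e. a smooth map such that \<open>\<pi>\<close> has smooth local sections over \<open>U\<close>.\<close>

definition quotient_manifold ::
  "'a::euclidean_space set \<Rightarrow> ('a \<Rightarrow> 'p) \<Rightarrow> ('p, 'a) manifold" where
  "quotient_manifold P \<pi> = \<lparr>points = \<pi> ` P,
     charts = {(U, \<phi>). U \<subseteq> \<pi> ` P \<and> openin (top_of_set P) (P \<inter> \<pi> -` U) \<and>
       coordinates U \<phi> \<and> smooth_on (P \<inter> \<pi> -` U) (\<phi> \<circ> \<pi>) \<and>
       (\<forall>y\<in>\<phi> ` U. \<exists>W s. openin (top_of_set (\<phi> ` U)) W \<and> y \<in> W \<and> smooth_on W s \<and>
          (\<forall>z\<in>W. s z \<in> P \<and> \<pi> (s z) = inv_into U \<phi> z))}\<rparr>"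


section \<open>Tangent bundles and tangent sphere bundles\<close>

text \<open>A tangent vector at \<open>p\<close> is an equivalence class of curves through \<open>p\<close> at time 0 and smooth
  near 0 (their values at other times are irrelevant). The base point can be recovered
  from the class, so the tangent bundle is just the set of all classes.\<close>

definition smooth_curve :: "('p, 'e::euclidean_space) manifold \<Rightarrow> (real \<Rightarrow> 'p) \<Rightarrow> bool" where
  "smooth_curve M c \<longleftrightarrow> (\<exists>(U, \<phi>)\<in>charts M. \<exists>\<epsilon>>0.
     c ` {-\<epsilon><..<\<epsilon>} \<subseteq> U \<and> smooth_on {-\<epsilon><..<\<epsilon>} (\<phi> \<circ> c))"

definition velocity :: "('p, 'e::euclidean_space) manifold \<Rightarrow> (real \<Rightarrow> 'p) \<Rightarrow> (real \<Rightarrow> 'p) set" where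
  "velocity M c = {d. smooth_curve M d \<and> d 0 = c 0 \<and>
     (\<forall>(U, \<phi>)\<in>charts M. c 0 \<in> U \<longrightarrow>
        vector_derivative (\<phi> \<circ> d) (at 0) = vector_derivative (\<phi> \<circ> c) (at 0))}"

definition base_point :: "(real \<Rightarrow> 'p) set \<Rightarrow> 'p" where
  "base_point X = (SOME c. c \<in> X) 0"

definition tangent_coord :: "('p \<Rightarrow> 'e::euclidean_space) \<Rightarrow> (real \<Rightarrow> 'p) set \<Rightarrow> 'e \<times> 'e" where
  "tangent_coord \<phi> X = (\<phi> (base_point X), vector_derivative (\<phi> \<circ> (SOME c. c \<in> X)) (at 0))"

definition tangent_vectors :: "('p, 'e::euclidean_space) manifold \<Rightarrow> (real \<Rightarrow> 'p) set set" where
  "tangent_vectors M = velocity M ` {c. smooth_curve M c}"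

definition tangent_bundle ::
  "('p, 'e::euclidean_space) manifold \<Rightarrow> ((real \<Rightarrow> 'p) set, 'e \<times> 'e) manifold" where
  "tangent_bundle M = \<lparr>points = tangent_vectors M,
     charts = (\<lambda>(U, \<phi>). ({X \<in> tangent_vectors M. base_point X \<in> U}, tangent_coord \<phi>)) ` charts M\<rparr>"

definition tangent_sphere_bundle ::
  "('p, 'e::euclidean_space) manifold \<Rightarrow> ((real \<Rightarrow> 'p) set \<Rightarrow> (real \<Rightarrow> 'p) set \<Rightarrow> real) \<Rightarrow> real
   \<Rightarrow> ((real \<Rightarrow> 'p) set, 'e \<times> 'e) manifold" where
  "tangent_sphere_bundle M g r =
     submanifold (tangent_bundle M) {X \<in> tangent_vectors M. sqrt (g X X) = r}"


section \<open>Projective spaces\<close>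

text \<open>Scalars act from the right; this matters for the quaternions only.\<close>

definition rscale :: "'k::times ^ 'n \<Rightarrow> 'k \<Rightarrow> 'k ^ 'n"  (infixl \<open>\<odot>\<close> 75) where
  "u \<odot> s = (\<chi> i. u $ i * s)"

definition line :: "'k::conj_div_algebra ^ 'n \<Rightarrow> ('k ^ 'n) set" where
  "line u = range (\<lambda>s. u \<odot> s)"

text \<open>The affine chart with index \<open>i\<close> sends the line through \<open>(x\<^sub>j)\<^sub>j\<close> to
  \<open>(x\<^sub>j x\<^sub>i\<^sup>-\<^sup>1)\<^sub>j\<close> with the \<open>i\<close>-th entry (which would be 1) replaced by 0.\<close>

definition affine_coord :: "'n \<Rightarrow> ('k::conj_div_algebra ^ 'n) set \<Rightarrow> 'k ^ 'n" where
  "affine_coord i L = (THE x. x \<in> L \<and> x $ i = 1) - axis i 1"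

definition projective_space :: "(('k::conj_div_algebra ^ 'n) set, 'k ^ 'n) manifold" where
  "projective_space = \<lparr>points = line ` (- {0}),
     charts = range (\<lambda>i. ({line x | x. x $ i \<noteq> 0}, affine_coord i))\<rparr>"

text \<open>The differential at \<open>u \<noteq> 0\<close> of the projection \<open>line\<close>, applied to \<open>v\<close>.\<close>

definition dline :: "'k::conj_div_algebra ^ 'n \<Rightarrow> 'k ^ 'n \<Rightarrow> (real \<Rightarrow> ('k ^ 'n) set) set" where
  "dline u v = velocity projective_space (\<lambda>t. line (u + t *\<^sub>R v))"

text \<open>The standard symmetric metric (Fubini--Study in the complex case), for which the projection
  from the unit sphere is a Riemannian submersion: the inner product of two tangent vectors at the
  same point is that of their horizontal lifts, i.e. the lifts orthogonal to the \<open>'k\<close>-line of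
  the base point. Other normalizations differ by a positive constant factor.\<close>

definition projective_metric ::
  "(real \<Rightarrow> ('k::conj_div_algebra ^ 'n) set) set \<Rightarrow> (real \<Rightarrow> ('k ^ 'n) set) set \<Rightarrow> real" where
  "projective_metric X Y = (THE a. \<exists>u v w. norm u = 1 \<and> (\<forall>y\<in>line u. v \<bullet> y = 0 \<and> w \<bullet> y = 0) \<and>
     X = dline u v \<and> Y = dline u w \<and> a = v \<bullet> w)"


section \<open>Stiefel manifolds\<close>

definition hermitian :: "'k::conj_div_algebra ^ 'n \<Rightarrow> 'k ^ 'n \<Rightarrow> 'k" where
  "hermitian u v = (\<Sum>i\<in>UNIV. conjug (u $ i) * v $ i)"

definition stiefel2 :: "(('k::conj_div_algebra ^ 'n) \<times> ('k ^ 'n)) set" where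
  "stiefel2 = {(u, v). hermitian u u = 1 \<and> hermitian v v = 1 \<and> hermitian u v = 0}"

definition frame_orbit ::
  "('k::conj_div_algebra ^ 'n) \<times> ('k ^ 'n) \<Rightarrow> (('k ^ 'n) \<times> ('k ^ 'n)) set" where
  "frame_orbit p = {(fst p \<odot> s, snd p \<odot> s) | s. norm s = 1}"

definition projective_stiefel2 ::
  "((('k::conj_div_algebra ^ 'n) \<times> ('k ^ 'n)) set, ('k ^ 'n) \<times> ('k ^ 'n)) manifold" where
  "projective_stiefel2 = quotient_manifold stiefel2 frame_orbit"

text \<open>The natural map between \<open>W\<^sub>2\<close> and \<open>T\<^sub>r\<close> sends the class of a frame \<open>(u, v)\<close> to the
  image of \<open>r v\<close> under the differential of the projection at \<open>u\<close>.\<close>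

definition natural_diffeomorphism ::
  "real \<Rightarrow> ((('k::conj_div_algebra ^ 'n) \<times> ('k ^ 'n)) set \<Rightarrow> (real \<Rightarrow> ('k ^ 'n) set) set) \<Rightarrow> bool" where
  "natural_diffeomorphism r F \<longleftrightarrow>
     diffeomorphism projective_stiefel2 (tangent_sphere_bundle projective_space projective_metric r) F \<and>
     (\<forall>(u, v)\<in>stiefel2. F (frame_orbit (u, v)) = dline u (r *\<^sub>R v))"

end

theory Submission
  imports Defs
begin

text \<open>A frame \<open>(u, v)\<close> is mapped to the image of \<open>r v\<close> under the differential at \<open>u\<close> of the projection
  \<open>line\<close>. Since \<open>v\<close> is horizontal, this image has length \<open>r\<close>; normalizing base points and taking
  horizontal lifts shows that every tangent vector of length \<open>r\<close> arises in this way, from a frame which is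
  unique up to a common unit scalar. For smoothness, take the affine chart of index \<open>i\<close> with the
  induced coordinates \<open>(x, \<xi>)\<close> of the tangent bundle. In the fibre over \<open>x\<close> the vectors of length \<open>r\<close> form
  an ellipsoid around 0, half of which central projection maps bijectively onto a hyperplane.
  Thus \<open>(x, \<xi>)\<close> goes to a point of a fixed linear space, independently of \<open>r\<close>, and every point of
  that space is reached. Lifting back by Gram--Schmidt gives a smooth section into the Stiefel
  manifold, so the same formula is a chart of both manifolds and the map is the identity in these
  charts.\<close>

section \<open>Calculus of smooth maps\<close>

text \<open>Openness of \<open>S\<close> turns agreement on \<open>S\<close> into agreement near
  each of its points; the derivatives then also agree on \<open>S\<close>, and the induction
  continues with them.\<close>

lemma Ck_on_cong:
  assumes "open S" "\<And>x. x \<in> S \<Longrightarrow> f x = g x" "Ck_on k f S"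
  shows "Ck_on k g S"
  using assms
proof (induction k arbitrary: f g)
  case 0
  then show ?case by (auto cong: continuous_on_cong)
next
  case (Suc k)
  have der: "(g has_derivative frechet_derivative f (at x)) (at x)" if "x \<in> S" for x
    using Suc.prems that frechet_derivative_works has_derivative_transform_within_open
    by (metis Ck_on.simps(2))
  then have eq: "frechet_derivative f (at x) v = frechet_derivative g (at x) v" if "x \<in> S" for x v
    using frechet_derivative_at[of g _ x] that by metis
  have "Ck_on k (\<lambda>x. frechet_derivative g (at x) v) S" for v
    by (rule Suc.IH[OF Suc.prems(1) eq[of _ v]]) (use Suc.prems(3) in simp_all)
  with der show ?case by (auto simp: differentiable_def)
qed

text \<open>Uniqueness of the derivative lets an explicit formula \<open>f'\<close> take the place
  of \<open>frechet_derivative\<close>; the product, inverse and square root rules are proved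
  through this.\<close>

lemma Ck_on_SucI:
  assumes "open S" "\<And>x. x \<in> S \<Longrightarrow> (f has_derivative f' x) (at x)"
    and "\<And>v. Ck_on k (\<lambda>x. f' x v) S"
  shows "Ck_on (Suc k) f S"
proof -
  have "Ck_on k (\<lambda>x. frechet_derivative f (at x) v) S" for v
    by (rule Ck_on_cong[OF assms(1) _ assms(3)[of v]])
      (simp add: frechet_derivative_at[OF assms(2), symmetric])
  with assms(2) show ?thesis by (auto simp: differentiable_def)
qed

lemma Ck_on_SucD:
  assumes "Ck_on (Suc k) f S"
  shows "x \<in> S \<Longrightarrow> (f has_derivative frechet_derivative f (at x)) (at x)"
    and "Ck_on k (\<lambda>x. frechet_derivative f (at x) v) S"
  using assms by (auto simp: frechet_derivative_works)

lemma Ck_on_Suc_imp_Ck_on: "Ck_on (Suc k) f S \<Longrightarrow> Ck_on k f S"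
proof (induction k arbitrary: f)
  case 0
  then show ?case
    by (auto intro!: continuous_at_imp_continuous_on differentiable_imp_continuous_within)
next
  case (Suc k)
  then show ?case by (metis Ck_on.simps(2))
qed

lemma Ck_on_subset: "Ck_on k f S \<Longrightarrow> T \<subseteq> S \<Longrightarrow> Ck_on k f T"
proof (induction k arbitrary: f)
  case 0
  then show ?case by (auto intro: continuous_on_subset)
next
  case (Suc k)
  then show ?case unfolding Ck_on.simps by blast
qed

lemma Ck_on_const: "Ck_on k (\<lambda>x. c) S"
  by (induction k arbitrary: c) auto

lemma Ck_on_id: "open S \<Longrightarrow> Ck_on k (\<lambda>x. x) S"
  by (cases k) (auto intro!: Ck_on_SucI derivative_eq_intros Ck_on_const)

lemma Ck_on_linear:
  assumes "bounded_linear L" "open S" "Ck_on k f S"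
  shows "Ck_on k (\<lambda>x. L (f x)) S"
  using assms(3)
proof (induction k arbitrary: f)
  case 0
  then show ?case using assms by (auto intro: bounded_linear.continuous_on)
next
  case (Suc k)
  show ?case
    by (rule Ck_on_SucI[where f' = "\<lambda>x v. L (frechet_derivative f (at x) v)"])
      (intro assms(2) bounded_linear.has_derivative[OF assms(1)] Suc.IH
        Ck_on_SucD[OF Suc.prems]; assumption)+
qed

lemma Ck_on_add:
  assumes "open S" "Ck_on k f S" "Ck_on k g S"
  shows "Ck_on k (\<lambda>x. f x + g x) S"
  using assms(2,3)
proof (induction k arbitrary: f g)
  case 0
  then show ?case by (auto intro: continuous_on_add)
next
  case (Suc k)
  show ?case
    by (rule Ck_on_SucI[where
          f' = "\<lambda>x v. frechet_derivative f (at x) v + frechet_derivative g (at x) v"])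
      (intro assms(1) has_derivative_add Suc.IH Suc.prems[THEN Ck_on_SucD(1)]
        Suc.prems[THEN Ck_on_SucD(2)]; assumption)+
qed

text \<open>The product rule leaves terms containing \<open>f\<close> and \<open>g\<close>
  themselves, so the induction also uses that each order of smoothness implies the preceding one.
  The factors keep their order, which covers quaternion products.\<close>

lemma Ck_on_bilinear:
  assumes B: "bounded_bilinear B" and "open S" "Ck_on k f S" "Ck_on k g S"
  shows "Ck_on k (\<lambda>x. B (f x) (g x)) S"
  using assms(3,4)
proof (induction k arbitrary: f g)
  case 0
  then show ?case using B by (auto intro: bounded_bilinear.continuous_on)
next
  case (Suc k)
  show ?case
  proof (rule Ck_on_SucI[OF assms(2) bounded_bilinear.FDERIV[OF B
          Suc.prems[THEN Ck_on_SucD(1)]]])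
    show "Ck_on k (\<lambda>x. B (f x) (frechet_derivative g (at x) v)
        + B (frechet_derivative f (at x) v) (g x)) S" for v
      using Suc.prems
      by (intro Ck_on_add assms(2) Suc.IH Ck_on_SucD(2) Ck_on_Suc_imp_Ck_on[of k])
  qed
qed

text \<open>The derivative is again built from \<open>inverse (f x)\<close>, whose smoothness of
  order \<open>k\<close> is the induction hypothesis; this yields order \<open>k + 1\<close>. The
  derivative has the two-sided, noncommutative form.\<close>

lemma Ck_on_inverse:
  fixes f :: "_ \<Rightarrow> 'k::real_normed_div_algebra"
  assumes "open S" "Ck_on k f S" "\<And>x. x \<in> S \<Longrightarrow> f x \<noteq> 0"
  shows "Ck_on k (\<lambda>x. inverse (f x)) S"
  using assms(2,3)
proof (induction k arbitrary: f)
  case 0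
  then show ?case by (auto intro: continuous_on_inverse)
next
  case (Suc k)
  show ?case
  proof (rule Ck_on_SucI[OF assms(1) Deriv.has_derivative_inverse[OF Suc.prems(2)
          Ck_on_SucD(1)[OF Suc.prems(1)]]])
    have k: "Ck_on k (\<lambda>x. inverse (f x)) S"
      using Suc by (auto simp del: Ck_on.simps intro: Suc.IH Ck_on_Suc_imp_Ck_on)
    show "Ck_on k (\<lambda>x. - (inverse (f x) * frechet_derivative f (at x) v * inverse (f x))) S" for v
      by (intro Ck_on_linear[OF bounded_linear_minus[OF bounded_linear_ident]]
          Ck_on_bilinear[OF bounded_bilinear_mult] assms(1) k Ck_on_SucD(2)[OF Suc.prems(1)])
  qed
qed

lemma Ck_on_sqrt:
  assumes "open S" "Ck_on k f S" "\<And>x. x \<in> S \<Longrightarrow> f x > 0"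
  shows "Ck_on k (\<lambda>x. sqrt (f x)) S"
  using assms(2,3)
proof (induction k arbitrary: f)
  case 0
  then show ?case by (auto intro: continuous_on_real_sqrt)
next
  case (Suc k)
  show ?case
  proof (rule Ck_on_SucI[OF assms(1)])
    fix x assume x: "x \<in> S"
    show "((\<lambda>x. sqrt (f x)) has_derivative
        (\<lambda>v. frechet_derivative f (at x) v * (inverse (sqrt (f x)) / 2))) (at x)"
      by (rule has_derivative_real_sqrt[THEN has_derivative_eq_rhs,
            OF Suc.prems(2)[OF x] Ck_on_SucD(1)[OF Suc.prems(1) x]])
        (auto simp: field_simps)
  next
    have k: "Ck_on k (\<lambda>x. sqrt (f x)) S"
      using Suc by (auto simp del: Ck_on.simps intro: Suc.IH Ck_on_Suc_imp_Ck_on)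
    show "Ck_on k (\<lambda>x. frechet_derivative f (at x) v * (inverse (sqrt (f x)) / 2)) S" for v
      unfolding divide_inverse
      by (intro Ck_on_bilinear[OF bounded_bilinear_mult] assms(1) Ck_on_inverse k Ck_on_const
          Ck_on_SucD(2)[OF Suc.prems(1)])
        (use Suc.prems in force)
  qed
qed

lemma Ck_on_diff:
  assumes "open S" "Ck_on k f S" "Ck_on k g S"
  shows "Ck_on k (\<lambda>x. f x - g x) S"
  using Ck_on_add[OF assms(1,2)
      Ck_on_linear[OF bounded_linear_minus[OF bounded_linear_ident] assms(1,3)]]
  by simp

lemma Ck_on_Pair:
  fixes f :: "'a::real_normed_vector \<Rightarrow> 'b::real_normed_vector"
    and g :: "'a \<Rightarrow> 'c::real_normed_vector"
  assumes "open S" "Ck_on k f S" "Ck_on k g S"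
  shows "Ck_on k (\<lambda>x. (f x, g x)) S"
proof -
  have "bounded_linear (\<lambda>x::'b. (x, 0::'c))" "bounded_linear (\<lambda>y::'c. (0::'b, y))"
    by (intro bounded_linear_Pair bounded_linear_ident bounded_linear_zero)+
  from Ck_on_add[OF assms(1) this[THEN Ck_on_linear, OF assms(1)], OF assms(2,3)]
  show ?thesis by simp
qed

lemmas Ck_on_intros = Ck_on_const Ck_on_id Ck_on_add Ck_on_diff Ck_on_Pair Ck_on_inverse
  Ck_on_linear[OF bounded_linear_fst] Ck_on_linear[OF bounded_linear_snd]
  Ck_on_linear[OF bounded_linear_vec_nth]
  Ck_on_bilinear[OF bounded_bilinear_mult] Ck_on_bilinear[OF bounded_bilinear_scaleR]
  Ck_on_bilinear[OF bounded_bilinear_inner]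

lemma smooth_onI:
  assumes "open T" "S \<subseteq> T" "\<And>k. Ck_on k g T" "\<And>y. y \<in> S \<Longrightarrow> f y = g y"
  shows "smooth_on S f"
  using assms unfolding smooth_on_def by blast

lemma smooth_on_id:
  assumes "\<And>y. y \<in> S \<Longrightarrow> f y = y"
  shows "smooth_on S f"
  by (rule smooth_onI[of UNIV _ "\<lambda>x. x"]) (use assms in \<open>auto intro: Ck_on_id\<close>)

section \<open>Hermitian algebra\<close>

text \<open>The axiom \<open>conjug_plus_self\<close> determines conjugation: it fixes the real axis
  and is minus the identity on its orthogonal complement. Involutivity and compatibility with real
  scalars are read off from this.\<close>

lemma conjug_eq: "conjug x = (2 * (x \<bullet> 1)) *\<^sub>R 1 - (x::'k::conj_div_algebra)"
  using conjug_plus_self[of x] by (simp add: algebra_simps)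

lemma conjug_conjug [simp]: "conjug (conjug x) = (x::'k::conj_div_algebra)"
  by (simp add: conjug_eq inner_diff_left dot_square_norm algebra_simps)

lemma conjug_scaleR: "conjug (a *\<^sub>R x) = a *\<^sub>R conjug (x::'k::conj_div_algebra)"
  by (simp add: conjug_eq algebra_simps)

text \<open>Polarization: expand \<open>conjug_mult_self\<close> at \<open>x + y\<close>. The mixed
  terms are twice the real part of \<open>conjug x * y\<close> on one side and twice the inner
  product on the other.\<close>

lemma inner_conjug: "x \<bullet> y = (conjug x * y) \<bullet> (1::'k::conj_div_algebra)"
proof -
  have "(2 * ((conjug x * y) \<bullet> 1)) *\<^sub>R 1 = conjug (conjug x * y) + conjug x * y"
    by (simp add: conjug_plus_self)
  also have "\<dots> = conjug (x + y) * (x + y) - conjug x * x - conjug y * y"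
    by (simp add: conjug_mult conjug_add algebra_simps)
  also have "\<dots> = (2 * (x \<bullet> y)) *\<^sub>R 1"
    unfolding conjug_mult_self power2_norm_eq_inner
    by (simp add: inner_add_left inner_add_right inner_commute flip: scaleR_diff_left)
  finally show ?thesis
    by (subst (asm) scaleR_cancel_right) simp
qed

lemma inner_mult_conjug: "(x * s) \<bullet> y = s \<bullet> (conjug x * (y::'k::conj_div_algebra))"
  by (subst (1 2) inner_conjug) (simp add: conjug_mult mult.assoc)

lemma rscale_nth [simp]: "(u \<odot> s) $ i = u $ i * s"
  by (simp add: rscale_def)

lemma rscale_1 [simp]: "u \<odot> (1::'k::monoid_mult) = u"
  by (simp add: vec_eq_iff)

lemma rscale_0 [simp]: "u \<odot> (0::'k::semiring_0) = 0"
  by (simp add: vec_eq_iff)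

lemma rscale_rscale [simp]: "u \<odot> s \<odot> t = u \<odot> (s * t :: 'k::semigroup_mult)"
  by (simp add: vec_eq_iff mult.assoc)

lemma rscale_add: "u \<odot> (s + t) = u \<odot> s + u \<odot> (t::'k::semiring)"
  by (simp add: vec_eq_iff distrib_left)

lemma rscale_add_left: "(u + v) \<odot> s = u \<odot> s + v \<odot> (s::'k::semiring)"
  by (simp add: vec_eq_iff distrib_right)

lemma rscale_scaleR:
  "u \<odot> (c *\<^sub>R s) = c *\<^sub>R (u \<odot> s)" "(c *\<^sub>R u) \<odot> s = c *\<^sub>R (u \<odot> (s::'k::real_algebra))"
  by (simp_all add: vec_eq_iff)

lemma norm_rscale: "norm (u \<odot> s) = norm u * norm (s::'k::real_normed_div_algebra)"
  by (simp add: norm_vec_def norm_mult L2_set_left_distrib)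

lemma rscale_eq_0_iff: "u \<odot> s = 0 \<longleftrightarrow> u = 0 \<or> s = (0::'k::real_normed_div_algebra)"
  using norm_rscale[of u s] by (metis norm_eq_zero mult_eq_0_iff)

lemma bounded_bilinear_rscale:
  "bounded_bilinear ((\<odot>) :: 'k::conj_div_algebra ^ 'n \<Rightarrow> _)"
  unfolding bilinear_conv_bounded_bilinear[symmetric] bilinear_def
  by (auto intro!: linearI simp: rscale_add rscale_add_left rscale_scaleR)

lemma bounded_bilinear_hermitian:
  "bounded_bilinear (hermitian :: 'k::conj_div_algebra ^ 'n \<Rightarrow> _)"
  unfolding bilinear_conv_bounded_bilinear[symmetric] bilinear_def hermitian_def
  by (auto intro!: linearI simp: conjug_add conjug_scaleR algebra_simps sum.distrib
      scaleR_sum_right)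

lemma hermitian_rscale_right: "hermitian u (v \<odot> s) = hermitian u v * s"
  by (simp add: hermitian_def sum_distrib_right mult.assoc)

lemma hermitian_rscale_left: "hermitian (u \<odot> s) v = conjug s * hermitian u v"
  by (simp add: hermitian_def sum_distrib_left mult.assoc conjug_mult)

lemma hermitian_self: "hermitian u u = (norm u)\<^sup>2 *\<^sub>R 1"
  by (simp add: hermitian_def conjug_mult_self power2_norm_eq_inner inner_vec_def
      flip: scaleR_sum_left)

text \<open>The real functional sending \<open>s\<close> to \<open>v \<bullet> (u \<odot> s)\<close>
  is represented by \<open>hermitian u v\<close>; testing it at \<open>s = hermitian u v\<close>
  shows that real orthogonality to the whole line forces the form to vanish.\<close>

lemma hermitian_eq_0_iff: "hermitian u v = 0 \<longleftrightarrow> (\<forall>y\<in>line u. v \<bullet> y = 0)"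
proof -
  have "v \<bullet> (u \<odot> s) = s \<bullet> hermitian u v" for s
    unfolding inner_commute[of v]
    by (simp add: inner_vec_def inner_mult_conjug hermitian_def inner_sum_right)
  then show ?thesis
    by (auto simp: line_def dest: spec[of _ "hermitian u v"])
qed

lemma hermitian_self_eq_1_iff:
  fixes u :: "'k::conj_div_algebra ^ 'n"
  shows "hermitian u u = 1 \<longleftrightarrow> norm u = 1"
proof -
  have "hermitian u u = 1 \<longleftrightarrow> (norm u)\<^sup>2 *\<^sub>R (1::'k) = 1 *\<^sub>R 1"
    by (simp add: hermitian_self)
  also have "\<dots> \<longleftrightarrow> (norm u)\<^sup>2 = 1"
    by (subst scaleR_cancel_right) simp
  also have "\<dots> \<longleftrightarrow> norm u = 1"
    using norm_ge_zero[of u] by (auto simp: power2_eq_1_iff simp del: norm_ge_zero)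
  finally show ?thesis .
qed

lemma stiefel2_iff:
  "(u, v) \<in> stiefel2 \<longleftrightarrow> norm u = 1 \<and> norm v = 1 \<and> hermitian u v = 0"
  by (simp add: stiefel2_def hermitian_self_eq_1_iff)

section \<open>Affine coordinates on the tangent bundle of projective space\<close>

text \<open>The affine chart in homogeneous coordinates, as a function of a spanning vector; unlike
  \<open>affine_coord\<close> it involves no definite description and can be differentiated
  directly.\<close>

definition line_coord :: "'n \<Rightarrow> 'k::conj_div_algebra ^ 'n \<Rightarrow> 'k ^ 'n" where
  "line_coord i u = u \<odot> inverse (u $ i) - axis i 1"

text \<open>The derivative of \<^const>\<open>line_coord\<close> at \<open>u\<close> in the direction \<open>v\<close>.\<close>

definition tangent_line_coord :: "'n \<Rightarrow> 'k::conj_div_algebra ^ 'n \<Rightarrow> 'k ^ 'n \<Rightarrow> 'k ^ 'n" where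
  "tangent_line_coord i u v = (v - u \<odot> (inverse (u $ i) * v $ i)) \<odot> inverse (u $ i)"

lemma Ck_on_line_coord:
  assumes "open S" "Ck_on k f S" "\<And>x. x \<in> S \<Longrightarrow> f x $ i \<noteq> 0"
  shows "Ck_on k (\<lambda>x. line_coord i (f x)) S"
  unfolding line_coord_def
  by (intro Ck_on_intros Ck_on_bilinear[OF bounded_bilinear_rscale] assms)

lemma Ck_on_tangent_line_coord:
  assumes "open S" "Ck_on k f S" "Ck_on k g S" "\<And>x. x \<in> S \<Longrightarrow> f x $ i \<noteq> 0"
  shows "Ck_on k (\<lambda>x. tangent_line_coord i (f x) (g x)) S"
  unfolding tangent_line_coord_def
  by (intro Ck_on_intros Ck_on_bilinear[OF bounded_bilinear_rscale] assms)

lemma line_coord_nth [simp]: "u $ i \<noteq> 0 \<Longrightarrow> line_coord i u $ i = 0"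
  by (simp add: line_coord_def)

lemma tangent_line_coord_nth [simp]: "u $ i \<noteq> 0 \<Longrightarrow> tangent_line_coord i u v $ i = 0"
  by (simp add: tangent_line_coord_def flip: mult.assoc)

lemma line_coord_rscale:
  "s \<noteq> 0 \<Longrightarrow> u $ i \<noteq> 0 \<Longrightarrow> line_coord i (u \<odot> s) = line_coord i u"
  by (simp add: line_coord_def nonzero_inverse_mult_distrib flip: mult.assoc)

text \<open>The vertical vectors \<open>u \<odot> h\<close> form the kernel of the differential of
  the projection, and a common scalar \<open>s\<close> only changes the representative of the
  tangent vector.\<close>

lemma tangent_line_coord_rscale:
  assumes "s \<noteq> 0" "u $ i \<noteq> 0"
  shows "tangent_line_coord i (u \<odot> s) (v \<odot> s + u \<odot> h) = tangent_line_coord i u v"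
proof -
  have "s * (inverse (u $ i * s) * (v $ i * s + u $ i * h)) = inverse (u $ i) * v $ i * s + h"
    using assms by (simp add: nonzero_inverse_mult_distrib distrib_left flip: mult.assoc)
  then have "v \<odot> s + u \<odot> h - u \<odot> (s * (inverse (u $ i * s) * (v $ i * s + u $ i * h)))
      = (v - u \<odot> (inverse (u $ i) * v $ i)) \<odot> s"
    by (simp add: vec_eq_iff algebra_simps)
  then have "tangent_line_coord i (u \<odot> s) (v \<odot> s + u \<odot> h)
      = (v - u \<odot> (inverse (u $ i) * v $ i)) \<odot> (s * inverse (u $ i * s))"
    by (simp add: tangent_line_coord_def)
  also have "s * inverse (u $ i * s) = inverse (u $ i)"
    using assms by (simp add: nonzero_inverse_mult_distrib flip: mult.assoc)
  finally show ?thesis by (simp add: tangent_line_coord_def)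
qed

lemma tangent_line_coord_scaleR:
  "tangent_line_coord i u (c *\<^sub>R v) = c *\<^sub>R tangent_line_coord i u v"
  by (simp add: tangent_line_coord_def rscale_scaleR flip: scaleR_diff_right)

lemma line_coord_add_axis: "line_coord i u + axis i 1 = u \<odot> inverse (u $ i)"
  by (simp add: line_coord_def)

text \<open>Normalizing entry \<open>i\<close> multiplies \<open>u\<close> by
  \<open>inverse (u $ i)\<close>, and the tangent coordinate is
  \<open>v \<odot> inverse (u $ i)\<close> up to a vertical vector, so
  \<open>tangent_line_coord_rscale\<close> gives the transition from chart \<open>i\<close> to chart
  \<open>j\<close>.\<close>

lemma line_coord_change:
  assumes "u $ i \<noteq> 0" "u $ j \<noteq> 0"
  shows "line_coord j (line_coord i u + axis i 1) = line_coord j u"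
    and "tangent_line_coord j (line_coord i u + axis i 1) (tangent_line_coord i u v)
      = tangent_line_coord j u v"
proof -
  show "line_coord j (line_coord i u + axis i 1) = line_coord j u"
    using assms by (simp add: line_coord_add_axis line_coord_rscale)
  have "tangent_line_coord i u v = v \<odot> inverse (u $ i)
      + u \<odot> (- (inverse (u $ i) * v $ i * inverse (u $ i)))"
    by (simp add: tangent_line_coord_def vec_eq_iff algebra_simps)
  then show "tangent_line_coord j (line_coord i u + axis i 1) (tangent_line_coord i u v)
      = tangent_line_coord j u v"
    using assms by (simp only: line_coord_add_axis) (simp add: tangent_line_coord_rscale)
qed

lemma line_coord_normalized:
  assumes "x $ i = 0" "\<xi> $ i = 0"
  shows "line_coord i (x + axis i 1) = x" "tangent_line_coord i (x + axis i 1) \<xi> = \<xi>"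
  using assms by (simp_all add: line_coord_def tangent_line_coord_def)

lemma has_vector_derivative_line_coord:
  assumes f: "(f has_vector_derivative v) (at t)" and nz: "f t $ i \<noteq> 0"
  shows "((\<lambda>t. line_coord i (f t)) has_vector_derivative tangent_line_coord i (f t) v) (at t)"
proof -
  have "((\<lambda>t. f t $ i) has_derivative (\<lambda>h. (h *\<^sub>R v) $ i)) (at t)"
    using f unfolding has_vector_derivative_def
    by (rule bounded_linear.has_derivative[OF bounded_linear_vec_nth])
  from Deriv.has_derivative_inverse[where f = "\<lambda>t. f t $ i", OF nz this]
  have "((\<lambda>t. inverse (f t $ i)) has_vector_derivative
      - (inverse (f t $ i) * v $ i * inverse (f t $ i))) (at t)"
    unfolding has_vector_derivative_def by simp
  from bounded_bilinear.has_vector_derivative[OF bounded_bilinear_rscale f this]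
  have "((\<lambda>t. line_coord i (f t)) has_vector_derivative
      f t \<odot> (- (inverse (f t $ i) * v $ i * inverse (f t $ i))) + v \<odot> inverse (f t $ i)) (at t)"
    unfolding line_coord_def by (auto intro!: derivative_eq_intros)
  also have "f t \<odot> (- (inverse (f t $ i) * v $ i * inverse (f t $ i))) + v \<odot> inverse (f t $ i)
      = tangent_line_coord i (f t) v"
    by (simp add: tangent_line_coord_def vec_eq_iff algebra_simps)
  finally show ?thesis .
qed

section \<open>Lines and their affine coordinates\<close>

lemma line_rscale: "s \<noteq> 0 \<Longrightarrow> line (u \<odot> s) = line u"
proof -
  assume "s \<noteq> 0"
  then have "u \<odot> t = u \<odot> (s * (inverse s * t))" for t
    by (simp flip: mult.assoc)
  then show ?thesis unfolding line_def by (auto intro: rangeI)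
qed

lemma self_in_line: "u \<in> line u"
  unfolding line_def by (metis rangeI rscale_1)

lemma line_eqE:
  assumes "line u = line u'" "u' \<noteq> 0"
  obtains s where "s \<noteq> 0" "u' = u \<odot> s"
  using assms self_in_line[of u'] unfolding line_def by (metis imageE rscale_0)

lemma affine_coord_line:
  assumes "u $ i \<noteq> 0"
  shows "affine_coord i (line u) = line_coord i u"
proof -
  have "(THE x. x \<in> line u \<and> x $ i = 1) = u \<odot> inverse (u $ i)"
  proof (rule the_equality)
    fix x assume "x \<in> line u \<and> x $ i = 1"
    then obtain s where "x = u \<odot> s" "u $ i * s = 1" by (auto simp: line_def)
    moreover from this have "s = inverse (u $ i)" by (metis inverse_unique)
    ultimately show "x = u \<odot> inverse (u $ i)" by simp
  qed (use assms in \<open>auto simp: line_def\<close>)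
  then show ?thesis by (simp add: affine_coord_def line_coord_def)
qed

lemma line_mem_affine_domain:
  "u \<noteq> 0 \<Longrightarrow> line u \<in> {line x | x. x $ i \<noteq> 0} \<longleftrightarrow> u $ i \<noteq> 0"
  by (auto elim!: line_eqE)

lemma line_affine_coord:
  assumes "L \<in> {line x | x. x $ i \<noteq> 0}"
  shows "line (affine_coord i L + axis i 1) = L"
  using assms by (auto simp: affine_coord_line line_coord_add_axis line_rscale)

lemma nz_nth: "u $ i \<noteq> 0 \<Longrightarrow> u \<noteq> 0"
  by auto

lemma nth_nzE:
  assumes "u \<noteq> 0"
  obtains i where "u $ i \<noteq> 0"
  using assms by (auto simp: vec_eq_iff)

section \<open>Curves of lines and their velocities\<close>

lemma has_vector_derivative_affine_coord:
  assumes f: "(f has_vector_derivative v) (at t)" and nz: "f t $ i \<noteq> 0"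
    and c: "\<forall>\<^sub>F t in nhds t. c t = line (f t)"
  shows "((affine_coord i \<circ> c) has_vector_derivative tangent_line_coord i (f t) v) (at t)"
proof -
  have "isCont (\<lambda>t. f t $ i) t"
    using f has_vector_derivative_continuous by (intro continuous_intros) blast
  then have "\<forall>\<^sub>F t in nhds t. f t $ i \<noteq> 0"
    using nz by (simp add: isCont_def tendsto_imp_eventually_ne eventually_nhds_conv_at)
  with c have "\<forall>\<^sub>F t in nhds t. line_coord i (f t) = (affine_coord i \<circ> c) t"
    by eventually_elim (simp add: affine_coord_line)
  then show ?thesis
    using has_vector_derivative_line_coord[OF f nz]
    by (subst has_vector_derivative_cong_ev[symmetric])
      (auto intro: eventually_mono dest: eventually_nhds_x_imp_x)
qed

text \<open>Putting the entry 1 dropped by the affine chart back in place lifts the curve of lines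
  to a curve of vectors near 0. The local smooth extension \<open>g\<close> of the coordinate curve
  supplies the derivative.\<close>

lemma smooth_curve_lineE:
  assumes "smooth_curve projective_space c"
  obtains f v where "(f has_vector_derivative v) (at 0)" "f 0 \<noteq> 0"
    "\<forall>\<^sub>F t in nhds 0. c t = line (f t)"
proof -
  from assms obtain i \<epsilon> where \<epsilon>: "\<epsilon> > 0" "c ` {-\<epsilon><..<\<epsilon>} \<subseteq> {line x | x. x $ i \<noteq> 0}"
    and smooth: "smooth_on {-\<epsilon><..<\<epsilon>} (affine_coord i \<circ> c)"
    by (auto simp: smooth_curve_def projective_space_def)
  have "0 \<in> {-\<epsilon><..<\<epsilon>}" using \<epsilon>(1) by simp
  from smooth[unfolded smooth_on_def, rule_format, OF this]
  obtain T g where T: "open T" "0 \<in> T" and Ck: "\<And>k. Ck_on k g T"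
    and eq: "\<And>t. t \<in> {-\<epsilon><..<\<epsilon>} \<inter> T \<Longrightarrow> (affine_coord i \<circ> c) t = g t"
    by blast
  have "g differentiable (at 0)"
    using Ck[of 1] T by simp
  then obtain v where v: "(g has_vector_derivative v) (at 0)"
    using vector_derivative_works by blast
  have near: "\<forall>\<^sub>F t in nhds 0. t \<in> {-\<epsilon><..<\<epsilon>} \<inter> T"
    using T \<epsilon>(1) by (intro eventually_nhds_in_open) auto
  have c: "c t = line (g t + axis i 1)" if "t \<in> {-\<epsilon><..<\<epsilon>} \<inter> T" for t
  proof -
    have "c t \<in> {line x | x. x $ i \<noteq> 0}" using that \<epsilon>(2) by blast
    then show ?thesis using line_affine_coord eq[OF that] by fastforce
  qed
  show ?thesis
  proof (rule that[of "\<lambda>t. g t + axis i 1" v])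
    show "((\<lambda>t. g t + axis i 1) has_vector_derivative v) (at 0)"
      using v by (auto intro!: derivative_eq_intros)
    have 0: "0 \<in> {-\<epsilon><..<\<epsilon>} \<inter> T" using T \<epsilon> by simp
    then have "c 0 \<in> {line x | x. x $ i \<noteq> 0}" using \<epsilon>(2) by blast
    then obtain x where "c 0 = line x" "x $ i \<noteq> 0" by blast
    then have "g 0 $ i = 0"
      using eq[OF 0] by (simp add: affine_coord_line flip: eq[OF 0])
    then show "g 0 + axis i 1 \<noteq> 0"
      by (intro nz_nth[of _ i]) simp
    show "\<forall>\<^sub>F t in nhds 0. c t = line (g t + axis i 1)"
      using near by eventually_elim (rule c)
  qed
qed

lemma smooth_curve_line:
  fixes u v :: "'k::conj_div_algebra ^ 'n"
  assumes "u \<noteq> 0"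
  shows "smooth_curve projective_space (\<lambda>t. line (u + t *\<^sub>R v))"
proof -
  obtain i where i: "u $ i \<noteq> 0" using assms by (rule nth_nzE)
  have "isCont (\<lambda>t. (u + t *\<^sub>R v) $ i) 0"
    by (intro continuous_intros)
  then have "\<forall>\<^sub>F t in nhds 0. (u + t *\<^sub>R v) $ i \<noteq> 0"
    using i by (simp only: isCont_def) (rule tendsto_imp_eventually_ne[THEN
      eventually_nhds_conv_at[THEN iffD2, OF conjI]], auto)
  then obtain \<epsilon> where \<epsilon>: "\<epsilon> > 0" "\<And>t. t \<in> {-\<epsilon><..<\<epsilon>} \<Longrightarrow> (u + t *\<^sub>R v) $ i \<noteq> 0"
    by (auto simp: eventually_nhds_metric dist_real_def abs_less_iff)
  have "smooth_on {-\<epsilon><..<\<epsilon>} (affine_coord i \<circ> (\<lambda>t. line (u + t *\<^sub>R v)))"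
    using \<epsilon>(2)
    by (intro smooth_onI[of "{-\<epsilon><..<\<epsilon>}" _ "\<lambda>t. line_coord i (u + t *\<^sub>R v)"]
        Ck_on_line_coord Ck_on_intros) (auto simp: affine_coord_line)
  moreover have "(\<lambda>t. line (u + t *\<^sub>R v)) ` {-\<epsilon><..<\<epsilon>} \<subseteq> {line x | x. x $ i \<noteq> 0}"
    using \<epsilon>(2) by blast
  ultimately show ?thesis
    using \<epsilon>(1) by (auto simp: smooth_curve_def projective_space_def)
qed

lemma velocity_projective_space:
  assumes "u \<noteq> 0" "c 0 = line u"
  shows "velocity projective_space c = {d. smooth_curve projective_space d \<and> d 0 = line u \<and>
    (\<forall>i. u $ i \<noteq> 0 \<longrightarrow> vector_derivative (affine_coord i \<circ> d) (at 0)
      = vector_derivative (affine_coord i \<circ> c) (at 0))}"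
proof -
  have "(\<forall>(U, \<phi>)\<in>charts projective_space. line u \<in> U \<longrightarrow> P \<phi>) \<longleftrightarrow>
      (\<forall>i. u $ i \<noteq> 0 \<longrightarrow> P (affine_coord i))" for P
    using line_mem_affine_domain[OF assms(1)] by (auto simp: projective_space_def)
  then show ?thesis by (simp add: velocity_def assms(2))
qed

text \<open>In every affine chart around the base point both curves have derivative
  \<open>tangent_line_coord i (f 0) v\<close>. Together with \<open>smooth_curve_lineE\<close> this
  shows that straight lifts represent all tangent vectors.\<close>

lemma velocity_eq_dline:
  assumes f: "(f has_vector_derivative v) (at 0)" and nz: "f 0 \<noteq> 0"
    and c: "\<forall>\<^sub>F t in nhds 0. c t = line (f t)"
  shows "velocity projective_space c = dline (f 0) v"
proof -
  let ?l = "\<lambda>t. line (f 0 + t *\<^sub>R v)"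
  have 0: "c 0 = line (f 0)" using c by (rule eventually_nhds_x_imp_x)
  have "vector_derivative (affine_coord i \<circ> c) (at 0)
      = vector_derivative (affine_coord i \<circ> ?l) (at 0)" if i: "f 0 $ i \<noteq> 0" for i
  proof -
    have "((\<lambda>t. f 0 + t *\<^sub>R v) has_vector_derivative v) (at 0)"
      by (auto intro!: derivative_eq_intros)
    from has_vector_derivative_affine_coord[OF this, of i ?l]
      has_vector_derivative_affine_coord[OF f i c]
    show ?thesis using i by (simp add: vector_derivative_at)
  qed
  with nz show ?thesis
    unfolding dline_def by (subst (1 2) velocity_projective_space[OF nz]) (simp_all add: 0)
qed

lemma tangent_vectors_projective_space:
  "tangent_vectors (projective_space :: (('k::conj_div_algebra ^ 'n) set, _) manifold)
    = {dline u v | u v. u \<noteq> 0}"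
proof -
  have "velocity projective_space c \<in> {dline u v | u v. u \<noteq> 0}"
    if "smooth_curve projective_space c" for c :: "real \<Rightarrow> ('k ^ 'n) set"
    using that by (rule smooth_curve_lineE) (use velocity_eq_dline in blast)
  moreover have "dline u v \<in> velocity projective_space ` {c. smooth_curve projective_space c}"
    if "u \<noteq> 0" for u v :: "'k ^ 'n"
    unfolding dline_def using smooth_curve_line[OF that] by blast
  ultimately show ?thesis
    unfolding tangent_vectors_def by blast
qed

text \<open>\<open>base_point\<close> and \<open>tangent_coord\<close> read a representative chosen
  by \<open>SOME\<close>; these are the data shared by all representatives, whatever the
  choice.\<close>

lemma dlineD:
  assumes u: "u \<noteq> 0" and c: "c \<in> dline u v"
  shows "c 0 = line u"
    and "u $ i \<noteq> 0 \<Longrightarrow>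
      vector_derivative (affine_coord i \<circ> c) (at 0) = tangent_line_coord i u v"
proof -
  let ?l = "\<lambda>t. line (u + t *\<^sub>R v)"
  have l0: "?l 0 = line u" by simp
  note c' = c[unfolded dline_def velocity_projective_space[where c = ?l, OF u l0] mem_Collect_eq]
  show "c 0 = line u" by (rule c'[THEN conjunct2, THEN conjunct1])
  assume i: "u $ i \<noteq> 0"
  have d: "((\<lambda>t. u + t *\<^sub>R v) has_vector_derivative v) (at 0)"
    by (auto intro!: derivative_eq_intros)
  have "vector_derivative (affine_coord i \<circ> c) (at 0)
      = vector_derivative (affine_coord i \<circ> ?l) (at 0)"
    by (rule c'[THEN conjunct2, THEN conjunct2, rule_format, OF i])
  also have "\<dots> = tangent_line_coord i u v"
    using has_vector_derivative_affine_coord[OF d, of i ?l] i by (simp add: vector_derivative_at)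
  finally show "vector_derivative (affine_coord i \<circ> c) (at 0) = tangent_line_coord i u v" .
qed

lemma some_in_dline:
  assumes "u \<noteq> 0"
  shows "(SOME c. c \<in> dline u v) \<in> dline u v"
proof -
  let ?l = "\<lambda>t. line (u + t *\<^sub>R v)"
  have l0: "?l 0 = line u" by simp
  have "?l \<in> dline u v"
    unfolding dline_def velocity_projective_space[where c = ?l, OF assms l0] mem_Collect_eq
    using smooth_curve_line[OF assms] l0 by (intro conjI allI impI refl)
  then show ?thesis by (rule someI[where P = "\<lambda>c. c \<in> dline u v"])
qed

lemma base_point_dline: "u \<noteq> 0 \<Longrightarrow> base_point (dline u v) = line u"
  unfolding base_point_def by (rule dlineD(1)[OF _ some_in_dline])

lemma tangent_coord_dline:
  assumes "u $ i \<noteq> 0"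
  shows "tangent_coord (affine_coord i) (dline u v) = (line_coord i u, tangent_line_coord i u v)"
proof -
  have nz: "u \<noteq> 0" using assms by (rule nz_nth)
  show ?thesis
    unfolding tangent_coord_def
    by (simp only: base_point_dline[OF nz] dlineD(2)[OF nz some_in_dline[OF nz] assms]
        affine_coord_line[OF assms])
qed

text \<open>Agreement in one chart suffices: \<open>line_coord_change\<close> carries it to every
  other chart \<open>j\<close> around the base point, as the definition of \<open>velocity\<close>
  demands.\<close>

lemma dline_eqI:
  assumes nz: "u $ i \<noteq> 0" "u' $ i \<noteq> 0" and eq: "line_coord i u = line_coord i u'"
    "tangent_line_coord i u v = tangent_line_coord i u' v'"
  shows "dline u v = dline u' v'"
proof -
  have line: "line u = line u'"
    using eq(1) nz by (metis line_coord_add_axis line_rscale inverse_nonzero_iff_nonzero)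
  have u: "u \<noteq> 0" "u' \<noteq> 0" using nz by (auto intro: nz_nth)
  have "vector_derivative (affine_coord j \<circ> (\<lambda>t. line (u + t *\<^sub>R v))) (at 0)
      = vector_derivative (affine_coord j \<circ> (\<lambda>t. line (u' + t *\<^sub>R v'))) (at 0)"
    if j: "u $ j \<noteq> 0" for j
  proof -
    have j': "u' $ j \<noteq> 0"
      using line_mem_affine_domain[OF u(1), of j] line_mem_affine_domain[OF u(2), of j] j
      unfolding line by blast
    have d: "((\<lambda>t. u + t *\<^sub>R v) has_vector_derivative v) (at 0)" for u v :: "'a ^ 'b"
      by (auto intro!: derivative_eq_intros)
    have "tangent_line_coord j u v = tangent_line_coord j u' v'"
      using line_coord_change(2)[OF nz(1) j, of v] line_coord_change(2)[OF nz(2) j', of v'] eq by simp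
    then show ?thesis
      using has_vector_derivative_affine_coord[OF d, of u v j "\<lambda>t. line (u + t *\<^sub>R v)"]
        has_vector_derivative_affine_coord[OF d, of u' v' j "\<lambda>t. line (u' + t *\<^sub>R v')"] j j'
      by (simp add: vector_derivative_at)
  qed
  then show ?thesis
    unfolding dline_def by (subst (1 2) velocity_projective_space[OF u(1)]) (simp_all add: line)
qed

section \<open>Horizontal lifts and the metric\<close>

lemma dline_rscale:
  assumes "u \<noteq> 0" "s \<noteq> 0"
  shows "dline (u \<odot> s) (v \<odot> s + u \<odot> h) = dline u v"
proof -
  obtain i where "u $ i \<noteq> 0" using assms(1) by (rule nth_nzE)
  with assms(2) show ?thesis
    by (intro dline_eqI[of _ i] line_coord_rscale tangent_line_coord_rscale) auto
qed

text \<open>Equal base points give \<open>s\<close>. The difference \<open>w\<close> of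
  \<open>v'\<close> and \<open>v \<odot> s\<close> then projects to zero, so it is vertical; being
  also horizontal, it vanishes.\<close>

lemma dline_horizontal_eqE:
  assumes eq: "dline u v = dline u' v'" and nz: "u \<noteq> 0" "u' \<noteq> 0"
    and hor: "hermitian u v = 0" "hermitian u' v' = 0"
  obtains s where "s \<noteq> 0" "u' = u \<odot> s" "v' = v \<odot> s"
proof -
  have "line u = line u'"
    using eq nz base_point_dline by metis
  then obtain s where s: "s \<noteq> 0" "u' = u \<odot> s"
    using nz by (auto elim: line_eqE)
  obtain i where i: "u' $ i \<noteq> 0" using nz(2) by (rule nth_nzE)
  have "dline u' v' = dline u' (v \<odot> s)"
    using dline_rscale[OF nz(1) s(1), of v 0] eq s(2) by simp
  then have t: "tangent_line_coord i u' v' = tangent_line_coord i u' (v \<odot> s)"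
    using tangent_coord_dline[OF i] by (metis prod.inject)
  define w h where "w = v' - v \<odot> s" and "h = inverse (u' $ i) * w $ i"
  have "(w - u' \<odot> h) \<odot> inverse (u' $ i) = 0"
    using t by (simp add: tangent_line_coord_def w_def h_def vec_eq_iff algebra_simps)
  then have w: "w = u' \<odot> h"
    using i by (auto simp: vec_eq_iff)
  have "hermitian u' (v \<odot> s) = 0"
    by (simp add: hor(1) s(2) hermitian_rscale_left hermitian_rscale_right)
  then have "hermitian u' w = 0"
    unfolding w_def bounded_bilinear.diff_right[OF bounded_bilinear_hermitian]
    by (simp add: hor(2))
  then have "h = 0"
    using nz(2) by (simp add: w hermitian_rscale_right hermitian_self)
  then have "v' = v \<odot> s" using w by (simp add: w_def)
  with s show ?thesis by (rule that)
qed

text \<open>The definite description is justified by uniqueness of lifts: horizontal lifts at two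
  unit vectors of a line differ by a common scalar of norm 1, which preserves lengths.\<close>

lemma projective_metric_dline:
  assumes "norm u = 1" "hermitian u v = 0"
  shows "projective_metric (dline u v) (dline u v) = (norm v)\<^sup>2"
  unfolding projective_metric_def
proof (rule the_equality)
  show "\<exists>u' v' w. norm u' = 1 \<and> (\<forall>y\<in>line u'. v' \<bullet> y = 0 \<and> w \<bullet> y = 0) \<and>
      dline u v = dline u' v' \<and> dline u v = dline u' w \<and> (norm v)\<^sup>2 = v' \<bullet> w"
    using assms hermitian_eq_0_iff power2_norm_eq_inner by blast
next
  fix a assume "\<exists>u' v' w. norm u' = 1 \<and> (\<forall>y\<in>line u'. v' \<bullet> y = 0 \<and> w \<bullet> y = 0) \<and>
      dline u v = dline u' v' \<and> dline u v = dline u' w \<and> a = v' \<bullet> w"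
  then obtain u' v' w where u': "norm u' = 1" and hor: "hermitian u' v' = 0" "hermitian u' w = 0"
    and eq: "dline u v = dline u' v'" "dline u v = dline u' w" and a: "a = v' \<bullet> w"
    unfolding hermitian_eq_0_iff by blast
  have nz: "u \<noteq> 0" "u' \<noteq> 0" using assms u' by auto
  from eq(1) nz assms(2) hor(1) obtain s where s: "s \<noteq> 0" "u' = u \<odot> s" "v' = v \<odot> s"
    by (rule dline_horizontal_eqE)
  \<comment> \<open>Two horizontal lifts at the same \<open>u'\<close> differ by a scalar
    \<open>t\<close> with \<open>u' = u' \<odot> t\<close>, which forces \<open>t = 1\<close> and
    hence \<open>w = v'\<close>.\<close>
  from eq(2)[symmetric, unfolded eq(1)] nz(2,2) hor(2,1) obtain t where
    "t \<noteq> 0" and t: "u' = u' \<odot> t" "v' = w \<odot> t"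
    by (rule dline_horizontal_eqE)
  obtain i where "u' $ i \<noteq> 0" using nz(2) by (rule nth_nzE)
  moreover have "u' $ i * t = u' $ i"
    using t(1) by (metis rscale_nth)
  ultimately have "t = 1" by simp
  then have "a = (norm v')\<^sup>2"
    using t(2) by (simp add: a power2_norm_eq_inner)
  moreover have "norm s = 1" using u' assms(1) by (simp add: s(2) norm_rscale)
  ultimately show "a = (norm v)\<^sup>2"
    by (simp add: s(3) norm_rscale)
qed

lemma unit_sphere_dline:
  assumes "r > 0"
  shows "{X \<in> tangent_vectors projective_space. sqrt (projective_metric X X) = r}
    = {dline u (r *\<^sub>R v) | u v. (u, v) \<in> stiefel2}" (is "?L = ?R")
proof
  show "?R \<subseteq> ?L"
  proof clarify
    fix u v :: "'a ^ 'b" assume "(u, v) \<in> stiefel2"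
    then have uv: "norm u = 1" "norm v = 1" "hermitian u v = 0"
      by (simp_all add: stiefel2_iff)
    then have "u \<noteq> 0" "hermitian u (r *\<^sub>R v) = 0"
      by (auto simp: bounded_bilinear.scaleR_right[OF bounded_bilinear_hermitian])
    with uv assms show "dline u (r *\<^sub>R v) \<in> tangent_vectors projective_space \<and>
        sqrt (projective_metric (dline u (r *\<^sub>R v)) (dline u (r *\<^sub>R v))) = r"
      by (auto simp: projective_metric_dline tangent_vectors_projective_space)
  qed
  show "?L \<subseteq> ?R"
  proof clarify
    fix X :: "(real \<Rightarrow> ('a ^ 'b) set) set"
    assume X: "X \<in> tangent_vectors projective_space" and r: "r = sqrt (projective_metric X X)"
    from X obtain u v where u: "u \<noteq> 0" and uv: "X = dline u v"
      by (auto simp: tangent_vectors_projective_space)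
    \<comment> \<open>The scalar \<open>s\<close> normalizes the base vector, and \<open>h\<close>
      removes from \<open>v \<odot> s\<close> its component along the line of \<open>u'\<close>.
      Neither changes the tangent vector.\<close>
    define s :: 'a where "s = inverse (norm u) *\<^sub>R 1"
    define u' h where "u' = u \<odot> s" and "h = - (s * hermitian u' (v \<odot> s))"
    define v' where "v' = v \<odot> s + u \<odot> h"
    have s: "s \<noteq> 0" using u by (simp add: s_def)
    have nu': "norm u' = 1" using u by (simp add: u'_def norm_rscale s_def)
    have "v' = v \<odot> s - u' \<odot> hermitian u' (v \<odot> s)"
      by (simp add: v'_def h_def u'_def vec_eq_iff)
    then have hor: "hermitian u' v' = 0"
      by (simp add: bounded_bilinear.diff_right[OF bounded_bilinear_hermitian]
          hermitian_rscale_right[of u' u'] hermitian_self nu')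
    have X': "X = dline u' v'"
      unfolding uv u'_def v'_def using dline_rscale[OF u s] by simp
    have "norm v' = r"
      using r nu' hor by (simp add: X' projective_metric_dline)
    then have "(u', v' /\<^sub>R r) \<in> stiefel2" "dline u' (r *\<^sub>R (v' /\<^sub>R r)) = X"
      using assms nu' hor X'
      by (auto simp: stiefel2_iff bounded_bilinear.scaleR_right[OF bounded_bilinear_hermitian])
    then show "\<exists>u v. X = dline u (sqrt (projective_metric X X) *\<^sub>R v) \<and> (u, v) \<in> stiefel2"
      unfolding r[symmetric] by (intro exI[of _ u'] exI[of _ "v' /\<^sub>R r"]) simp
  qed
qed

section \<open>Charts of the two manifolds\<close>

text \<open>The central projection of the half space \<open>\<zeta> \<bullet> a > 0\<close> onto the hyperplane orthogonal to \<open>a\<close>. It is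
  invariant under positive scaling, hence a chart of an open hemisphere of any ellipsoid.\<close>

definition gnomonic :: "'a::real_inner \<Rightarrow> 'a \<Rightarrow> 'a" where
  "gnomonic a \<zeta> = inverse (\<zeta> \<bullet> a) *\<^sub>R \<zeta> - inverse (a \<bullet> a) *\<^sub>R a"

lemma gnomonic_scaleR: "c \<noteq> 0 \<Longrightarrow> gnomonic a (c *\<^sub>R \<zeta>) = gnomonic a \<zeta>"
  by (simp add: gnomonic_def)

lemma gnomonic_orthogonal: "\<zeta> \<bullet> a \<noteq> 0 \<Longrightarrow> gnomonic a \<zeta> \<bullet> a = 0"
  by (cases "a = 0") (simp_all add: gnomonic_def inner_diff_left)

text \<open>The point \<open>w + inverse (a \<bullet> a) *\<^sub>R a\<close> is where the ray
  projected to \<open>w\<close> meets the affine hyperplane of height 1; it serves to invert the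
  central projection.\<close>

lemma gnomonic_section:
  assumes "a \<noteq> 0" "w \<bullet> a = 0"
  shows "(w + inverse (a \<bullet> a) *\<^sub>R a) \<bullet> a = 1" "gnomonic a (w + inverse (a \<bullet> a) *\<^sub>R a) = w"
  using assms by (simp_all add: gnomonic_def inner_add_left)

lemma gnomonic_eqD:
  assumes "gnomonic a \<zeta> = gnomonic a \<zeta>'" "\<zeta> \<bullet> a > 0" "\<zeta>' \<bullet> a > 0"
  obtains c where "c > 0" "\<zeta> = c *\<^sub>R \<zeta>'"
proof
  show "(\<zeta> \<bullet> a) * inverse (\<zeta>' \<bullet> a) > 0" using assms by simp
  have "inverse (\<zeta> \<bullet> a) *\<^sub>R \<zeta> = inverse (\<zeta>' \<bullet> a) *\<^sub>R \<zeta>'"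
    using assms(1) by (simp add: gnomonic_def)
  then have "(\<zeta> \<bullet> a) *\<^sub>R (inverse (\<zeta> \<bullet> a) *\<^sub>R \<zeta>) = (\<zeta> \<bullet> a) *\<^sub>R (inverse (\<zeta>' \<bullet> a) *\<^sub>R \<zeta>')"
    by simp
  then show "\<zeta> = ((\<zeta> \<bullet> a) * inverse (\<zeta>' \<bullet> a)) *\<^sub>R \<zeta>'" using assms(2) by simp
qed

text \<open>Formulated for all pairs of vectors rather than for frames only, so that it is open in
  the ambient space and can carry the smooth extensions of chart formulas.\<close>

definition frame_domain :: "'n \<Rightarrow> 'k::conj_div_algebra ^ 'n \<Rightarrow> (('k ^ 'n) \<times> ('k ^ 'n)) set" where
  "frame_domain i a = {p. fst p $ i \<noteq> 0 \<and> 0 < tangent_line_coord i (fst p) (snd p) \<bullet> a}"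

definition frame_coord ::
  "'n \<Rightarrow> 'k::conj_div_algebra ^ 'n \<Rightarrow> ('k ^ 'n) \<times> ('k ^ 'n) \<Rightarrow> ('k ^ 'n) \<times> ('k ^ 'n)" where
  "frame_coord i a p =
    (line_coord i (fst p), gnomonic a (tangent_line_coord i (fst p) (snd p)))"

text \<open>The linear model of both manifolds: entry \<open>i\<close> is lost in affine
  coordinates, and the direction \<open>a\<close> is lost in the central projection.\<close>

definition coord_space :: "'n \<Rightarrow> 'k::conj_div_algebra ^ 'n \<Rightarrow> (('k ^ 'n) \<times> ('k ^ 'n)) set" where
  "coord_space i a = {z. fst z $ i = 0 \<and> snd z $ i = 0 \<and> snd z \<bullet> a = 0}"

text \<open>A positive multiple of the component of \<open>\<zeta>\<close> orthogonal to the line of \<open>y\<close>.\<close>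

definition horizontal :: "'k::conj_div_algebra ^ 'n \<Rightarrow> 'k ^ 'n \<Rightarrow> 'k ^ 'n" where
  "horizontal y \<zeta> = (y \<bullet> y) *\<^sub>R \<zeta> - y \<odot> hermitian y \<zeta>"

text \<open>The smooth section inverting \<^const>\<open>frame_coord\<close> up to the action of the unit scalars.\<close>

definition lift_frame ::
  "'n \<Rightarrow> 'k::conj_div_algebra ^ 'n \<Rightarrow> ('k ^ 'n) \<times> ('k ^ 'n) \<Rightarrow> ('k ^ 'n) \<times> ('k ^ 'n)" where
  "lift_frame i a z =
    (let y = fst z + axis i 1; v = horizontal y (snd z + inverse (a \<bullet> a) *\<^sub>R a)
     in (inverse (sqrt (y \<bullet> y)) *\<^sub>R y, inverse (sqrt (v \<bullet> v)) *\<^sub>R v))"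

text \<open>The open set on which both radicands in \<open>lift_frame\<close> are positive, so that
  its formula is smooth there.\<close>

definition lift_domain :: "'n \<Rightarrow> 'k::conj_div_algebra ^ 'n \<Rightarrow> (('k ^ 'n) \<times> ('k ^ 'n)) set" where
  "lift_domain i a = {z. let y = fst z + axis i 1; v = horizontal y (snd z + inverse (a \<bullet> a) *\<^sub>R a)
     in 0 < y \<bullet> y \<and> 0 < v \<bullet> v}"

section \<open>Smoothness of the coordinates and of the section\<close>

lemma open_Ck_preimage:
  assumes "open S" "\<And>k. Ck_on k f S" "open A"
  shows "open {x \<in> S. f x \<in> A}"
  using continuous_open_preimage[OF _ assms(1,3), of f] assms(2)[of 0]
  by (simp add: Int_def vimage_def)

lemma open_nth_nz: "open {p :: ('k::conj_div_algebra ^ 'n) \<times> 'b::real_normed_vector. fst p $ i \<noteq> 0}"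
  using open_Ck_preimage[of UNIV "\<lambda>p. fst p $ i" "- {0}"]
  by (simp add: Ck_on_intros open_delete[of UNIV, unfolded Compl_eq_Diff_UNIV[symmetric]])

lemma open_frame_domain: "open (frame_domain i a)"
proof -
  have "frame_domain i a = {p \<in> {p. fst p $ i \<noteq> 0}.
      tangent_line_coord i (fst p) (snd p) \<bullet> a \<in> {0<..}}"
    by (auto simp: frame_domain_def)
  also have "open \<dots>"
    by (intro open_Ck_preimage open_nth_nz Ck_on_intros Ck_on_tangent_line_coord) auto
  finally show ?thesis .
qed

lemma Ck_on_frame_coord:
  assumes "open S" "Ck_on k f S" "\<And>x. x \<in> S \<Longrightarrow> f x \<in> frame_domain i a"
  shows "Ck_on k (\<lambda>x. frame_coord i a (f x)) S"
  using assms unfolding frame_coord_def gnomonic_def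
  by (intro Ck_on_intros Ck_on_line_coord Ck_on_tangent_line_coord)
    (auto simp: frame_domain_def dest: assms(3) simp del: Ck_on.simps)

lemma Ck_on_horizontal:
  assumes "open S" "Ck_on k f S" "Ck_on k g S"
  shows "Ck_on k (\<lambda>x. horizontal (f x) (g x)) S"
  unfolding horizontal_def
  by (intro Ck_on_intros Ck_on_bilinear[OF bounded_bilinear_rscale]
      Ck_on_bilinear[OF bounded_bilinear_hermitian] assms)

lemma open_lift_domain: "open (lift_domain i a)"
proof -
  have "lift_domain i a =
      {z \<in> UNIV. (fst z + axis i 1) \<bullet> (fst z + axis i 1) \<in> {0<..}} \<inter>
      {z \<in> UNIV. horizontal (fst z + axis i 1) (snd z + inverse (a \<bullet> a) *\<^sub>R a) \<bullet>
        horizontal (fst z + axis i 1) (snd z + inverse (a \<bullet> a) *\<^sub>R a) \<in> {0<..}}"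
    by (auto simp: lift_domain_def Let_def)
  also have "open \<dots>"
    by (intro open_Int open_Ck_preimage open_UNIV Ck_on_intros Ck_on_horizontal) auto
  finally show ?thesis .
qed

lemma Ck_on_lift_frame: "Ck_on k (lift_frame i a) (lift_domain i a)"
  unfolding lift_frame_def Let_def
  by (intro Ck_on_intros Ck_on_horizontal Ck_on_sqrt open_lift_domain)
    (auto simp: lift_domain_def Let_def)

lemma subspace_coord_space: "subspace (coord_space i a)"
  by (auto simp: subspace_def coord_space_def inner_add_left)

lemma frame_coord_mem_coord_space:
  assumes "p \<in> frame_domain i a" "a $ i = 0"
  shows "frame_coord i a p \<in> coord_space i a"
  using assms
  by (auto simp: coord_space_def frame_coord_def frame_domain_def gnomonic_orthogonal)
    (simp add: gnomonic_def)

text \<open>Up to the common scalar \<open>s\<close>, the second vector of the lift is a positive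
  multiple of \<zeta> plus a vertical vector. Tangent coordinates return the multiple of \<zeta>,
  and the central projection forgets the factor.\<close>

lemma lift_frame_works:
  assumes a: "a \<noteq> 0" "a $ i = 0" and z: "z \<in> coord_space i a"
  shows "z \<in> lift_domain i a" "lift_frame i a z \<in> stiefel2"
    "lift_frame i a z \<in> frame_domain i a" "frame_coord i a (lift_frame i a z) = z"
proof -
  obtain x w where xw: "z = (x, w)" by (cases z)
  define y where "y = x + axis i 1"
  define \<zeta> where "\<zeta> = w + inverse (a \<bullet> a) *\<^sub>R a"
  define v where "v = horizontal y \<zeta>"
  have i: "x $ i = 0" "w $ i = 0" "w \<bullet> a = 0"
    using z by (simp_all add: xw coord_space_def)
  then have y1: "y $ i = 1" and \<zeta>0: "\<zeta> $ i = 0" and \<zeta>a: "\<zeta> \<bullet> a = 1" and gno: "gnomonic a \<zeta> = w"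
    using gnomonic_section[OF a(1), of w] a by (simp_all add: y_def \<zeta>_def)
  have y: "y \<noteq> 0" using y1 by (intro nz_nth[of _ i]) simp
  \<comment> \<open>\<zeta> cannot be vertical: entry \<open>i\<close> is 0 in \<zeta> and 1 in
    \<open>y\<close>, so a vertical \<zeta> would be 0, against
    \<open>\<zeta> \<bullet> a = 1\<close>.\<close>
  have v: "v \<noteq> 0"
  proof
    assume "v = 0"
    then have eq: "(y \<bullet> y) *\<^sub>R \<zeta> = y \<odot> hermitian y \<zeta>" by (simp add: v_def horizontal_def)
    from arg_cong[OF this, of "\<lambda>u. u $ i"] have "hermitian y \<zeta> = 0" by (simp add: \<zeta>0 y1)
    with eq y have "\<zeta> = 0" by simp
    with \<zeta>a show False by simp
  qed
  have hor: "hermitian y v = 0"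
    by (simp add: v_def horizontal_def bounded_bilinear.diff_right[OF bounded_bilinear_hermitian]
        bounded_bilinear.scaleR_right[OF bounded_bilinear_hermitian] hermitian_rscale_right
        hermitian_self power2_norm_eq_inner)
  have lift: "lift_frame i a z = (inverse (norm y) *\<^sub>R y, inverse (norm v) *\<^sub>R v)"
    by (simp add: lift_frame_def Let_def xw v_def y_def \<zeta>_def norm_eq_sqrt_inner)
  show "z \<in> lift_domain i a"
    using y v by (simp add: lift_domain_def Let_def xw v_def y_def \<zeta>_def)
  show "lift_frame i a z \<in> stiefel2"
    using y v hor
    by (simp add: lift stiefel2_iff bounded_bilinear.scaleR_right[OF bounded_bilinear_hermitian]
        bounded_bilinear.scaleR_left[OF bounded_bilinear_hermitian])
  \<comment> \<open>With these factors the lift is \<open>y \<odot> s\<close> followed by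
    \<open>(c *\<^sub>R \<zeta>) \<odot> s + y \<odot> h\<close>, the form to which
    \<open>tangent_line_coord_rscale\<close> applies.\<close>
  define s h c where "s = inverse (norm y) *\<^sub>R (1::'a)"
    and "h = - (inverse (norm v) *\<^sub>R hermitian y \<zeta>)"
    and "c = inverse (norm v) * (y \<bullet> y) * norm y"
  have c: "c > 0" using y v by (simp add: c_def)
  have s: "s \<noteq> 0" using y by (simp add: s_def)
  have u': "inverse (norm y) *\<^sub>R y = y \<odot> s" by (simp add: s_def rscale_scaleR)
  have v': "inverse (norm v) *\<^sub>R v = (c *\<^sub>R \<zeta>) \<odot> s + y \<odot> h"
    using y unfolding s_def h_def c_def v_def[unfolded horizontal_def]
    by (simp add: rscale_scaleR vec_eq_iff algebra_simps)
  have coords: "line_coord i (inverse (norm y) *\<^sub>R y) = x"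
    "tangent_line_coord i (inverse (norm y) *\<^sub>R y) (inverse (norm v) *\<^sub>R v) = c *\<^sub>R \<zeta>"
    unfolding u' v' using s i \<zeta>0 y1
    by (simp_all add: line_coord_rscale tangent_line_coord_rscale tangent_line_coord_scaleR)
      (simp_all add: y_def line_coord_normalized)
  show "lift_frame i a z \<in> frame_domain i a"
    using c y by (simp add: lift frame_domain_def coords y1 \<zeta>a)
  show "frame_coord i a (lift_frame i a z) = z"
    using c by (simp add: lift frame_coord_def coords gnomonic_scaleR gno) (simp add: xw)
qed

section \<open>Orbits of frames and their tangent vectors\<close>

lemma frame_orbitE:
  assumes "q \<in> frame_orbit p"
  obtains s where "norm s = 1" "q = (fst p \<odot> s, snd p \<odot> s)"
  using assms by (auto simp: frame_orbit_def)

lemma self_in_frame_orbit: "p \<in> frame_orbit p"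
  by (auto simp: frame_orbit_def intro!: exI[of _ 1])

lemma frame_orbit_rscale:
  assumes "norm s = 1"
  shows "frame_orbit (fst p \<odot> s, snd p \<odot> s) = frame_orbit p"
proof -
  have s: "s \<noteq> 0" using assms by auto
  show ?thesis
  proof (intro equalityI subsetI)
    fix q assume "q \<in> frame_orbit (fst p \<odot> s, snd p \<odot> s)"
    then show "q \<in> frame_orbit p"
      by (rule frame_orbitE) (use assms in \<open>auto simp: frame_orbit_def norm_mult\<close>)
  next
    fix q assume "q \<in> frame_orbit p"
    then obtain t where "norm t = 1" "q = (fst p \<odot> t, snd p \<odot> t)" by (rule frame_orbitE)
    moreover have "s * (inverse s * t) = t" using s by (simp flip: mult.assoc)
    ultimately show "q \<in> frame_orbit (fst p \<odot> s, snd p \<odot> s)"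
      using assms unfolding frame_orbit_def
      by (auto simp: norm_mult norm_inverse intro!: exI[of _ "inverse s * t"])
  qed
qed

definition frame_velocity ::
  "real \<Rightarrow> ('k::conj_div_algebra ^ 'n) \<times> ('k ^ 'n) \<Rightarrow> (real \<Rightarrow> ('k ^ 'n) set) set" where
  "frame_velocity r p = dline (fst p) (r *\<^sub>R snd p)"

lemma stiefel2_nz: "p \<in> stiefel2 \<Longrightarrow> fst p \<noteq> 0"
  by (cases p) (auto simp: stiefel2_iff)

text \<open>Uniqueness of horizontal lifts yields a common scalar, of norm 1 since both base vectors
  are unit vectors. The two directions make the natural map injective and well defined on
  orbits.\<close>

lemma frame_velocity_eq_iff:
  assumes r: "r > 0" and p: "p \<in> stiefel2" and q: "q \<in> stiefel2"
  shows "frame_velocity r p = frame_velocity r q \<longleftrightarrow> frame_orbit p = frame_orbit q"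
proof
  obtain u v u' v' where pq: "p = (u, v)" "q = (u', v')" by (cases p, cases q)
  have uv: "norm u = 1" "hermitian u (r *\<^sub>R v) = 0" "norm u' = 1" "hermitian u' (r *\<^sub>R v') = 0"
    using p q by (auto simp: pq stiefel2_iff bounded_bilinear.scaleR_right[OF bounded_bilinear_hermitian])
  have nz: "u \<noteq> 0" "u' \<noteq> 0" using uv by auto
  {
    assume "frame_velocity r p = frame_velocity r q"
    then have "dline u (r *\<^sub>R v) = dline u' (r *\<^sub>R v')"
      by (simp add: frame_velocity_def pq)
    then obtain s where s: "u' = u \<odot> s" "r *\<^sub>R v' = (r *\<^sub>R v) \<odot> s"
      using nz uv(2,4) by (rule dline_horizontal_eqE)
    then have "norm s = 1" "v' = v \<odot> s"
      using uv r by (simp_all add: norm_rscale rscale_scaleR)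
    with s(1) show "frame_orbit p = frame_orbit q"
      using frame_orbit_rscale[of s p] by (simp add: pq)
  }
  assume "frame_orbit p = frame_orbit q"
  then have "q \<in> frame_orbit p" by (simp add: self_in_frame_orbit)
  then obtain s where s: "norm s = 1" "q = (u \<odot> s, v \<odot> s)"
    by (rule frame_orbitE) (simp add: pq)
  then have "s \<noteq> 0" by auto
  from dline_rscale[OF nz(1) this, of "r *\<^sub>R v" 0]
  show "frame_velocity r p = frame_velocity r q"
    by (simp add: frame_velocity_def pq(1) s(2) rscale_scaleR)
qed

lemma frame_domain_scaleR:
  "r > 0 \<Longrightarrow> (u, r *\<^sub>R v) \<in> frame_domain i a \<longleftrightarrow> (u, v) \<in> frame_domain i a"
  by (simp add: frame_domain_def tangent_line_coord_scaleR zero_less_mult_iff)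

lemma frame_coord_scaleR:
  "r > 0 \<Longrightarrow> frame_coord i a (u, r *\<^sub>R v) = frame_coord i a (u, v)"
  by (simp add: frame_coord_def tangent_line_coord_scaleR gnomonic_scaleR)

lemma frame_orbit_frame_domain:
  assumes "frame_orbit p = frame_orbit q" "p \<in> frame_domain i a"
  shows "q \<in> frame_domain i a"
proof -
  have "q \<in> frame_orbit p" using assms(1) by (simp add: self_in_frame_orbit)
  then obtain s where s: "norm s = 1" "q = (fst p \<odot> s, snd p \<odot> s)" by (rule frame_orbitE)
  then have "s \<noteq> 0" by auto
  with assms(2) show ?thesis
    using tangent_line_coord_rscale[of s "fst p" i "snd p" 0] by (simp add: s frame_domain_def)
qed

text \<open>The coordinates determine the line, and the tangent vector up to a factor
  \<open>c > 0\<close>; horizontal lifting then gives a common scalar \<open>s\<close>. Comparing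
  norms of the first and second vectors forces \<open>norm s = 1\<close> and
  \<open>c = 1\<close>.\<close>

lemma frame_coord_inj:
  assumes p: "p \<in> stiefel2 \<inter> frame_domain i a" and q: "q \<in> stiefel2 \<inter> frame_domain i a"
    and eq: "frame_coord i a p = frame_coord i a q"
  shows "frame_orbit p = frame_orbit q"
proof -
  obtain u v u' v' where pq: "p = (u, v)" "q = (u', v')" by (cases p, cases q)
  have uv: "norm u = 1" "norm v = 1" "hermitian u v = 0"
    and uv': "norm u' = 1" "norm v' = 1" "hermitian u' v' = 0"
    using p q by (auto simp: pq stiefel2_iff)
  have nz: "u \<noteq> 0" "u' \<noteq> 0" using uv uv' by auto
  from eq have "gnomonic a (tangent_line_coord i u v) = gnomonic a (tangent_line_coord i u' v')"
    by (simp add: frame_coord_def pq)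
  then obtain c where c: "c > 0" "tangent_line_coord i u v = c *\<^sub>R tangent_line_coord i u' v'"
    by (rule gnomonic_eqD) (use p q in \<open>auto simp: frame_domain_def pq\<close>)
  have "dline u v = dline u' (c *\<^sub>R v')"
    using p q eq c
    by (intro dline_eqI[of _ i])
      (auto simp: frame_domain_def pq frame_coord_def tangent_line_coord_scaleR)
  then obtain s where s: "u' = u \<odot> s" "c *\<^sub>R v' = v \<odot> s"
    using nz uv(3)
    by (rule dline_horizontal_eqE)
      (simp add: uv' bounded_bilinear.scaleR_right[OF bounded_bilinear_hermitian])
  have "norm s = 1" using uv(1) uv'(1) s(1) by (simp add: norm_rscale)
  moreover have "c = 1"
    using arg_cong[OF s(2), of norm] c(1) uv uv' \<open>norm s = 1\<close> by (simp add: norm_rscale)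
  ultimately show ?thesis
    using frame_orbit_rscale[of s p] s by (simp add: pq)
qed

definition sphere_coord ::
  "'n \<Rightarrow> 'k::conj_div_algebra ^ 'n \<Rightarrow> (real \<Rightarrow> ('k ^ 'n) set) set \<Rightarrow> ('k ^ 'n) \<times> ('k ^ 'n)" where
  "sphere_coord i a X = (fst (tangent_coord (affine_coord i) X),
    gnomonic a (snd (tangent_coord (affine_coord i) X)))"

lemma sphere_coord_frame_velocity:
  assumes "r > 0" "p \<in> frame_domain i a"
  shows "sphere_coord i a (frame_velocity r p) = frame_coord i a p"
  using assms
  by (simp add: sphere_coord_def frame_velocity_def frame_domain_def tangent_coord_dline
      frame_coord_def tangent_line_coord_scaleR gnomonic_scaleR)

definition sphere_map ::
  "real \<Rightarrow> (('k::conj_div_algebra ^ 'n) \<times> ('k ^ 'n)) set \<Rightarrow> (real \<Rightarrow> ('k ^ 'n) set) set" where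
  "sphere_map r Q = frame_velocity r (SOME p. p \<in> Q)"

lemma sphere_map_frame_orbit:
  assumes "r > 0" "p \<in> stiefel2"
  shows "sphere_map r (frame_orbit p) = frame_velocity r p"
proof -
  define q where "q = (SOME q. q \<in> frame_orbit p)"
  have "q \<in> frame_orbit p"
    unfolding q_def by (rule someI[of "\<lambda>q. q \<in> frame_orbit p", OF self_in_frame_orbit])
  then obtain s where s: "norm s = 1" "q = (fst p \<odot> s, snd p \<odot> s)" by (rule frame_orbitE)
  then have "q \<in> stiefel2"
    using assms(2) by (cases p)
      (simp add: stiefel2_iff norm_rscale hermitian_rscale_left hermitian_rscale_right)
  moreover have "frame_orbit q = frame_orbit p"
    unfolding s(2) by (rule frame_orbit_rscale[OF s(1)])
  ultimately show ?thesis
    unfolding sphere_map_def q_def[symmetric]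
    by (rule frame_velocity_eq_iff[OF assms(1) _ assms(2), THEN iffD2])
qed

lemma sphere_points:
  assumes "r > 0"
  shows "{X \<in> tangent_vectors projective_space. sqrt (projective_metric X X) = r}
    = frame_velocity r ` stiefel2"
  unfolding unit_sphere_dline[OF assms] frame_velocity_def by force

text \<open>The image is all of a linear subspace, hence open in it.\<close>

lemma coordinates_onto:
  assumes "inj_on \<phi> U" "\<phi> ` U = coord_space i a"
  shows "coordinates U \<phi>"
  unfolding coordinates_def assms(2)
  using assms(1) subspace_coord_space openin_subtopology_self by blast

text \<open>The charts below of the two manifolds correspond to each other under \<^const>\<open>sphere_map\<close> and are
  onto the linear space \<^const>\<open>coord_space\<close>, so that in these charts the map is the identity.\<close>

context
  fixes i :: "'n::finite" and a :: "'k::conj_div_algebra ^ 'n" and r :: real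
  assumes a: "a \<noteq> 0" "a $ i = 0" and r: "r > 0"
begin

lemma frame_coord_image: "frame_coord i a ` (stiefel2 \<inter> frame_domain i a) = coord_space i a"
proof (intro equalityI subsetI)
  fix z assume "z \<in> coord_space i a"
  from lift_frame_works(2-4)[OF a this]
  show "z \<in> frame_coord i a ` (stiefel2 \<inter> frame_domain i a)"
    by (intro image_eqI[of _ _ "lift_frame i a z"]) auto
qed (use a(2) in \<open>auto intro: frame_coord_mem_coord_space\<close>)

lemma stiefel_chart:
  "(frame_orbit ` (stiefel2 \<inter> frame_domain i a), sphere_coord i a \<circ> sphere_map r)
    \<in> charts projective_stiefel2"
proof -
  let ?P = "stiefel2 \<inter> frame_domain i a"
  let ?U = "frame_orbit ` ?P" and ?\<phi> = "sphere_coord i a \<circ> sphere_map r"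
  have \<phi>: "?\<phi> (frame_orbit p) = frame_coord i a p" if "p \<in> ?P" for p
    using that r by (simp add: sphere_map_frame_orbit sphere_coord_frame_velocity)
  \<comment> \<open>The frame domain is invariant under unit scalars, so openness and smoothness can
    be checked on the frames themselves.\<close>
  have pre: "stiefel2 \<inter> frame_orbit -` ?U = ?P"
    by (auto intro: frame_orbit_frame_domain)
  have inj: "inj_on ?\<phi> ?U"
  proof (rule inj_onI)
    fix X Y assume X: "X \<in> ?U" and Y: "Y \<in> ?U" and eq: "?\<phi> X = ?\<phi> Y"
    from X Y obtain p q where p: "p \<in> ?P" "X = frame_orbit p" and q: "q \<in> ?P" "Y = frame_orbit q"
      by blast
    from eq show "X = Y"
      unfolding p(2) q(2) \<phi>[OF p(1)] \<phi>[OF q(1)] by (rule frame_coord_inj[OF p(1) q(1)])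
  qed
  have img: "?\<phi> ` ?U = coord_space i a"
    unfolding frame_coord_image[symmetric] image_image by (intro image_cong refl \<phi>)
  have "openin (top_of_set stiefel2) ?P"
    by (intro openin_open_Int open_frame_domain)
  moreover have "smooth_on ?P (?\<phi> \<circ> frame_orbit)"
    by (rule smooth_onI[OF open_frame_domain[of i a], where g = "frame_coord i a"])
      (auto simp: \<phi>[unfolded o_def] simp del: Ck_on.simps
        intro!: Ck_on_frame_coord[OF _ Ck_on_id] open_frame_domain)
  moreover have "\<exists>W s. openin (top_of_set (coord_space i a)) W \<and> y \<in> W \<and> smooth_on W s \<and>
      (\<forall>z\<in>W. s z \<in> stiefel2 \<and> frame_orbit (s z) = inv_into ?U ?\<phi> z)"
    if "y \<in> coord_space i a" for y
  \<comment> \<open>The section \<open>lift_frame i a\<close> is defined over the entire image, so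
    one \<open>W\<close> serves every \<open>y\<close>.\<close>
  proof (intro exI[of _ "coord_space i a"] exI[of _ "lift_frame i a"] conjI ballI that)
    show "openin (top_of_set (coord_space i a)) (coord_space i a)" by simp
    show "smooth_on (coord_space i a) (lift_frame i a)"
      by (rule smooth_onI[OF open_lift_domain[of i a] _ Ck_on_lift_frame])
        (use lift_frame_works(1)[OF a] in auto)
    fix z assume z: "z \<in> coord_space i a"
    note l = lift_frame_works(2-4)[OF a z]
    show "lift_frame i a z \<in> stiefel2" by (rule l)
    have P: "lift_frame i a z \<in> ?P" using l by blast
    show "frame_orbit (lift_frame i a z) = inv_into ?U ?\<phi> z"
      by (rule inv_into_f_eq[OF inj, symmetric]) (use P l(3) \<phi>[OF P] in auto)
  qed
  ultimately show ?thesis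
    unfolding projective_stiefel2_def quotient_manifold_def manifold.select_convs mem_Collect_eq
      case_prod_conv pre img
    using coordinates_onto[OF inj img] by (intro conjI ballI image_mono Int_lower1)
qed

lemma sphere_coord_inj: "inj_on (sphere_coord i a) (frame_velocity r ` (stiefel2 \<inter> frame_domain i a))"
proof (rule inj_onI)
  let ?P = "stiefel2 \<inter> frame_domain i a"
  fix X Y assume "X \<in> frame_velocity r ` ?P" "Y \<in> frame_velocity r ` ?P"
    and eq: "sphere_coord i a X = sphere_coord i a Y"
  then obtain p q where p: "p \<in> ?P" "X = frame_velocity r p"
    and q: "q \<in> ?P" "Y = frame_velocity r q"
    by blast
  from p q eq have "frame_coord i a p = frame_coord i a q"
    by (simp add: sphere_coord_frame_velocity[OF r])
  then have "frame_orbit p = frame_orbit q" by (rule frame_coord_inj[OF p(1) q(1)])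
  with p(1) q(1) show "X = Y"
    unfolding p(2) q(2) by (intro frame_velocity_eq_iff[OF r, THEN iffD2]) auto
qed

lemma sphere_coord_image:
  "sphere_coord i a ` frame_velocity r ` (stiefel2 \<inter> frame_domain i a) = coord_space i a"
  unfolding frame_coord_image[symmetric] image_image
  by (intro image_cong refl) (simp add: sphere_coord_frame_velocity[OF r])

text \<open>The pair \<open>z\<close> represents the same tangent vector as \<open>(u, v)\<close>,
  normalized to have entry \<open>j\<close> equal to 1 in its first vector. This expresses
  \<open>frame_coord i a\<close> in the coordinates of tangent chart \<open>j\<close>.\<close>

lemma change_of_frame_chart:
  fixes u v :: "'k ^ 'n"
  assumes "u $ j \<noteq> 0"
  defines "z \<equiv> (line_coord j u + axis j 1, tangent_line_coord j u v)"
  shows "z \<in> frame_domain i a \<longleftrightarrow> (u, v) \<in> frame_domain i a"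
    and "(u, v) \<in> frame_domain i a \<Longrightarrow> frame_coord i a z = frame_coord i a (u, v)"
proof -
  have "(line_coord j u + axis j 1) $ i \<noteq> 0 \<longleftrightarrow> u $ i \<noteq> 0"
    using assms(1) by (simp only: line_coord_add_axis) simp
  then show "z \<in> frame_domain i a \<longleftrightarrow> (u, v) \<in> frame_domain i a"
    using line_coord_change[OF assms(1), of i]
    by (auto simp: frame_domain_def z_def simp del: vector_add_component)
  show "(u, v) \<in> frame_domain i a \<Longrightarrow> frame_coord i a z = frame_coord i a (u, v)"
    using line_coord_change[OF assms(1), of i]
    by (simp add: frame_domain_def frame_coord_def z_def)
qed

lemma sphere_chart:
  "(frame_velocity r ` (stiefel2 \<inter> frame_domain i a), sphere_coord i a)
    \<in> charts (tangent_sphere_bundle projective_space projective_metric r)"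
proof -
  let ?P = "stiefel2 \<inter> frame_domain i a" and ?N = "frame_velocity r ` stiefel2"
  let ?V = "frame_velocity r ` ?P" and ?\<psi> = "sphere_coord i a"
  have N: "fst p \<noteq> 0 \<and> frame_velocity r p \<in> tangent_vectors projective_space"
    if "p \<in> stiefel2" for p :: "('k ^ 'n) \<times> ('k ^ 'n)"
    using stiefel2_nz[OF that]
    unfolding frame_velocity_def tangent_vectors_projective_space by blast
  have coords: "openin (top_of_set (\<phi> ` (?N \<inter> U))) (\<phi> ` (?V \<inter> U)) \<and>
      openin (top_of_set (?\<psi> ` ?V)) (?\<psi> ` (?V \<inter> U)) \<and>
      smooth_on (\<phi> ` (?V \<inter> U)) (?\<psi> \<circ> inv_into U \<phi>) \<and>
      smooth_on (?\<psi> ` (?V \<inter> U)) (\<phi> \<circ> inv_into ?V ?\<psi>)"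
    if \<phi>: "\<phi> = tangent_coord (affine_coord j)"
      and U: "U = {X \<in> tangent_vectors projective_space. base_point X \<in> {line x | x. x $ j \<noteq> 0}}"
    for U \<phi> and j :: 'n
  proof (intro conjI)
    \<comment> \<open>\<open>D\<close> is the frame domain seen in the coordinates of tangent chart
      \<open>j\<close>, with the dropped entry 1 restored. Multiplying the tangent vector by
      \<open>r\<close> does not affect membership.\<close>
    define D where "D = {z. (fst z + axis j 1, snd z) \<in> frame_domain i a}"
    have U_iff: "frame_velocity r p \<in> U \<longleftrightarrow> fst p $ j \<noteq> 0" if "p \<in> stiefel2" for p
      using N[OF that] line_mem_affine_domain[of "fst p" j]
      by (simp add: U frame_velocity_def base_point_dline)
    have \<phi>_eq: "\<phi> (frame_velocity r p) =
        (line_coord j (fst p), tangent_line_coord j (fst p) (r *\<^sub>R snd p))"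
      if "fst p $ j \<noteq> 0" for p
      using that by (simp add: \<phi> frame_velocity_def tangent_coord_dline)
    have D_iff: "\<phi> (frame_velocity r p) \<in> D \<longleftrightarrow> p \<in> frame_domain i a" if "fst p $ j \<noteq> 0" for p
      using change_of_frame_chart(1)[OF that, of "r *\<^sub>R snd p"] frame_domain_scaleR[OF r, of "fst p" "snd p"]
      by (simp add: D_def \<phi>_eq[OF that])
    have inj: "inj_on \<phi> U"
    proof (rule inj_onI)
      fix X Y assume XY: "X \<in> U" "Y \<in> U" "\<phi> X = \<phi> Y"
      then obtain u v u' v' where uv: "X = dline u v" "Y = dline u' v'" "u \<noteq> 0" "u' \<noteq> 0"
        by (auto simp: U tangent_vectors_projective_space)
      then have "u $ j \<noteq> 0" "u' $ j \<noteq> 0"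
        using XY(1,2) line_mem_affine_domain[of u j] line_mem_affine_domain[of u' j]
        by (simp_all add: U base_point_dline)
      with XY(3) show "X = Y"
        unfolding uv by (intro dline_eqI[of _ j]) (simp_all add: \<phi> uv tangent_coord_dline)
    qed
    have open_D: "open D"
      using open_Ck_preimage[OF open_UNIV _ open_frame_domain[of i a],
          of "\<lambda>z. (fst z + axis j 1, snd z)"]
      by (simp add: D_def Ck_on_intros del: Ck_on.simps)
    have "\<phi> ` (?V \<inter> U) = \<phi> ` (?N \<inter> U) \<inter> D"
      using U_iff D_iff by blast
    then show "openin (top_of_set (\<phi> ` (?N \<inter> U))) (\<phi> ` (?V \<inter> U))"
      using open_D by (simp add: openin_open_Int)
    have \<psi>_eq: "?\<psi> (frame_velocity r p) = frame_coord i a p" if "p \<in> ?P" for p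
      using that by (simp add: sphere_coord_frame_velocity[OF r])
    \<comment> \<open>In the coordinates belonging to index \<open>i\<close>, chart \<open>j\<close>
      covers exactly the lines whose entry \<open>j\<close> is nonzero once the dropped 1 is
      restored.\<close>
    define E :: "(('k ^ 'n) \<times> ('k ^ 'n)) set" where "E = {z. (fst z + axis i 1) $ j \<noteq> 0}"
    have open_E: "open E"
      using open_Ck_preimage[OF open_UNIV _ open_nth_nz[of j], of "\<lambda>z. (fst z + axis i 1, snd z)"]
      by (simp add: E_def Ck_on_intros del: Ck_on.simps vector_add_component)
    have E_iff: "?\<psi> (frame_velocity r p) \<in> E \<longleftrightarrow> fst p $ j \<noteq> 0" if "p \<in> ?P" for p
    proof -
      have "fst p $ i \<noteq> 0" using that by (simp add: frame_domain_def)
      then show ?thesis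
        unfolding E_def \<psi>_eq[OF that] frame_coord_def fst_conv line_coord_add_axis mem_Collect_eq
        by simp
    qed
    have \<psi>_VU: "?\<psi> ` (?V \<inter> U) = coord_space i a \<inter> E"
      unfolding sphere_coord_image[symmetric] using U_iff E_iff by blast
    then show "openin (top_of_set (?\<psi> ` ?V)) (?\<psi> ` (?V \<inter> U))"
      using open_E by (simp add: openin_open_Int sphere_coord_image)
    show "smooth_on (\<phi> ` (?V \<inter> U)) (?\<psi> \<circ> inv_into U \<phi>)"
    proof (rule smooth_onI[OF open_D, where g = "\<lambda>z. frame_coord i a (fst z + axis j 1, snd z)"])
      show "\<phi> ` (?V \<inter> U) \<subseteq> D" using U_iff D_iff by blast
      show "Ck_on k (\<lambda>z. frame_coord i a (fst z + axis j 1, snd z)) D" for k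
        by (intro Ck_on_frame_coord Ck_on_intros open_D) (simp add: D_def)
      fix y assume "y \<in> \<phi> ` (?V \<inter> U)"
      then obtain p where p: "p \<in> ?P" "frame_velocity r p \<in> U" and y: "y = \<phi> (frame_velocity r p)"
        by blast
      have j: "fst p $ j \<noteq> 0" using U_iff p by blast
      have "(?\<psi> \<circ> inv_into U \<phi>) y = frame_coord i a (fst p, snd p)"
        by (simp add: y inv_into_f_f[OF inj p(2)] \<psi>_eq[OF p(1)])
      also have "\<dots> = frame_coord i a (fst p, r *\<^sub>R snd p)"
        by (simp add: frame_coord_scaleR[OF r])
      also have "\<dots> = frame_coord i a (fst y + axis j 1, snd y)"
        using change_of_frame_chart(2)[OF j, of "r *\<^sub>R snd p"] p(1)
          frame_domain_scaleR[OF r, of "fst p" "snd p" i a]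
        by (simp add: y \<phi>_eq[OF j])
      finally show "(?\<psi> \<circ> inv_into U \<phi>) y = frame_coord i a (fst y + axis j 1, snd y)" .
    qed
    let ?l = "lift_frame i a"
    \<comment> \<open>The inverse transition map: lift to a frame, multiply its second vector by
      \<open>r\<close>, and read off the tangent coordinates with index \<open>j\<close>.\<close>
    let ?g = "\<lambda>z. (line_coord j (fst (?l z)), tangent_line_coord j (fst (?l z)) (r *\<^sub>R snd (?l z)))"
    have l_nz: "fst (?l z) $ j \<noteq> 0" if "z \<in> lift_domain i a \<inter> E" for z
      using that by (auto simp: lift_frame_def lift_domain_def Let_def E_def simp del: vector_add_component)
    show "smooth_on (?\<psi> ` (?V \<inter> U)) (\<phi> \<circ> inv_into ?V ?\<psi>)"
    proof (rule smooth_onI[where T = "lift_domain i a \<inter> E" and g = ?g])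
      show op: "open (lift_domain i a \<inter> E)" by (intro open_Int open_lift_domain open_E)
      show sub: "?\<psi> ` (?V \<inter> U) \<subseteq> lift_domain i a \<inter> E"
        unfolding \<psi>_VU using lift_frame_works(1)[OF a] by blast
      show "Ck_on k ?g (lift_domain i a \<inter> E)" for k
        by (intro Ck_on_intros Ck_on_line_coord Ck_on_tangent_line_coord op l_nz
            Ck_on_subset[OF Ck_on_lift_frame]) auto
      fix z assume z: "z \<in> ?\<psi> ` (?V \<inter> U)"
      then have "z \<in> coord_space i a" unfolding \<psi>_VU by blast
      note l = lift_frame_works(2-4)[OF a this]
      have P: "?l z \<in> ?P" using l by blast
      have "inv_into ?V ?\<psi> z = frame_velocity r (?l z)"
        by (rule inv_into_f_eq[OF sphere_coord_inj]) (use P l(3) \<psi>_eq[OF P] in auto)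
      then show "(\<phi> \<circ> inv_into ?V ?\<psi>) z = ?g z"
        using \<phi>_eq[OF l_nz[OF subsetD[OF sub z]]] by (simp only: o_apply)
    qed
  qed
  have "charts (tangent_bundle projective_space) = range (\<lambda>j::'n.
      ({X \<in> tangent_vectors projective_space. base_point X \<in> {line x | x :: 'k ^ 'n. x $ j \<noteq> 0}},
        tangent_coord (affine_coord j)))"
    by (auto simp: tangent_bundle_def projective_space_def image_image)
  then have "\<forall>(U, \<phi>)\<in>charts (tangent_bundle projective_space).
      openin (top_of_set (\<phi> ` (?N \<inter> U))) (\<phi> ` (?V \<inter> U)) \<and>
      openin (top_of_set (?\<psi> ` ?V)) (?\<psi> ` (?V \<inter> U)) \<and>
      smooth_on (\<phi> ` (?V \<inter> U)) (?\<psi> \<circ> inv_into U \<phi>) \<and>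
      smooth_on (?\<psi> ` (?V \<inter> U)) (\<phi> \<circ> inv_into ?V ?\<psi>)"
    using coords[OF refl refl] by (simp only: ball_simps case_prod_conv simp_thms)
  then show ?thesis
    unfolding tangent_sphere_bundle_def sphere_points[OF r] submanifold_def manifold.select_convs
      mem_Collect_eq case_prod_conv
    using coordinates_onto[OF sphere_coord_inj sphere_coord_image]
    by (intro conjI image_mono Int_lower1)
qed

end

section \<open>Covering by charts and the natural diffeomorphism\<close>

lemma frame_chart_exists:
  assumes "p \<in> stiefel2"
  obtains i a where "a \<noteq> 0" "a $ i = 0" "p \<in> frame_domain i a"
proof -
  obtain u v where p: "p = (u, v)" by (cases p)
  have uv: "norm u = 1" "norm v = 1" "hermitian u v = 0"
    using assms by (simp_all add: p stiefel2_iff)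
  have "u \<noteq> 0" using uv(1) by auto
  then obtain i where i: "u $ i \<noteq> 0" by (rule nth_nzE)
  \<comment> \<open>The tangent coordinate of the frame itself serves as the axis, since
    \<open>a \<bullet> a > 0\<close> puts the frame in the domain. If \<open>a\<close> were 0, then
    \<open>v\<close> would be both vertical and horizontal, against
    \<open>norm v = 1\<close>.\<close>
  define a where "a = tangent_line_coord i u v"
  have "a \<noteq> 0"
  proof
    assume "a = 0"
    define h where "h = inverse (u $ i) * v $ i"
    from \<open>a = 0\<close> i have v: "v = u \<odot> h"
      by (simp add: a_def tangent_line_coord_def rscale_eq_0_iff h_def)
    with uv(1,3) have "h = 0"
      by (simp add: hermitian_rscale_right hermitian_self)
    with v uv(2) show False by simp
  qed
  moreover have "a $ i = 0" using i by (simp add: a_def)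
  moreover have "p \<in> frame_domain i a" using i \<open>a \<noteq> 0\<close> by (simp add: p frame_domain_def a_def)
  ultimately show ?thesis by (rule that)
qed

text \<open>Here \<open>\<psi> \<circ> F\<close> is used as a chart of \<open>M\<close>, so that both coordinate representations are
  the identity.\<close>

lemma diffeomorphism_transported_charts:
  assumes bij: "bij_betw F (points M) (points N)"
    and ch: "\<And>x. x \<in> points M \<Longrightarrow> \<exists>U \<psi>. x \<in> U \<and> U \<subseteq> points M \<and> inj_on (\<psi> \<circ> F) U \<and>
      (U, \<psi> \<circ> F) \<in> charts M \<and> (F ` U, \<psi>) \<in> charts N"
  shows "diffeomorphism M N F"
proof -
  let ?G = "inv_into (points M) F"
  have inj: "inj_on F (points M)" and onto: "F ` points M = points N"
    using bij by (auto simp: bij_betw_def)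
  have "smooth_map M N F"
    unfolding smooth_map_def
  proof (intro conjI ballI)
    fix x assume "x \<in> points M"
    then obtain U \<psi> where U: "x \<in> U" "U \<subseteq> points M" and inj_U: "inj_on (\<psi> \<circ> F) U"
      and charts: "(U, \<psi> \<circ> F) \<in> charts M" "(F ` U, \<psi>) \<in> charts N" using ch by blast
    have eq: "U \<inter> F -` F ` U = U" by blast
    have "smooth_on ((\<psi> \<circ> F) ` U) (\<psi> \<circ> F \<circ> inv_into U (\<psi> \<circ> F))"
      by (rule smooth_on_id) (use f_inv_into_f[of _ "\<psi> \<circ> F" U] in auto)
    then show "\<exists>(U, \<phi>)\<in>charts M. \<exists>(V, \<psi>)\<in>charts N. x \<in> U \<and> F x \<in> V \<and>
        openin (top_of_set (\<phi> ` U)) (\<phi> ` (U \<inter> F -` V)) \<and>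
        smooth_on (\<phi> ` (U \<inter> F -` V)) (\<psi> \<circ> F \<circ> inv_into U \<phi>)"
      by (intro bexI[OF _ charts(1)] case_prodI bexI[OF _ charts(2)]) (use U eq in simp)
  qed (use onto in auto)
  moreover have "smooth_map N M ?G"
    unfolding smooth_map_def
  proof (intro conjI ballI)
    show "?G ` points N \<subseteq> points M"
      unfolding onto[symmetric] by (intro image_subsetI inv_into_into)
  next
    fix y assume "y \<in> points N"
    then obtain x where x: "x \<in> points M" "y = F x" using onto by blast
    then obtain U \<psi> where U: "x \<in> U" "U \<subseteq> points M" and inj_U: "inj_on (\<psi> \<circ> F) U"
      and charts: "(U, \<psi> \<circ> F) \<in> charts M" "(F ` U, \<psi>) \<in> charts N" using ch by blast
    have G: "?G (F x) = x" if "x \<in> U" for x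
      using that U(2) inj by (auto intro: inv_into_f_f)
    have inj_\<psi>: "inj_on \<psi> (F ` U)" using inj_U by (rule inj_on_imageI)
    have eq: "F ` U \<inter> ?G -` U = F ` U" using G by auto
    have "smooth_on (\<psi> ` F ` U) (\<psi> \<circ> F \<circ> ?G \<circ> inv_into (F ` U) \<psi>)"
      by (rule smooth_on_id) (auto simp: inv_into_f_f[OF inj_\<psi>] G)
    then show "\<exists>(V, \<psi>)\<in>charts N. \<exists>(U, \<phi>)\<in>charts M. y \<in> V \<and> ?G y \<in> U \<and>
        openin (top_of_set (\<psi> ` V)) (\<psi> ` (V \<inter> ?G -` U)) \<and>
        smooth_on (\<psi> ` (V \<inter> ?G -` U)) (\<phi> \<circ> ?G \<circ> inv_into V \<psi>)"
      by (intro bexI[OF _ charts(2)] case_prodI bexI[OF _ charts(1)])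
        (use U eq x G in \<open>simp add: o_assoc\<close>)
  qed
  ultimately show ?thesis by (simp add: diffeomorphism_def bij)
qed

text \<open>Every frame lies in some frame domain, and there the chart from
  \<open>stiefel_chart\<close> is the chart from \<open>sphere_chart\<close> composed with
  \<open>sphere_map r\<close>; this is the situation of
  \<open>diffeomorphism_transported_charts\<close>.\<close>

lemma natural_diffeomorphism_sphere_map:
  assumes r: "r > 0"
  shows "natural_diffeomorphism r
    (sphere_map r :: (('k::conj_div_algebra ^ 'n) \<times> ('k ^ 'n)) set \<Rightarrow> (real \<Rightarrow> ('k ^ 'n) set) set)"
proof -
  let ?F = "sphere_map r :: (('k ^ 'n) \<times> ('k ^ 'n)) set \<Rightarrow> (real \<Rightarrow> ('k ^ 'n) set) set"
  let ?N = "tangent_sphere_bundle projective_space projective_metric r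
    :: ((real \<Rightarrow> ('k ^ 'n) set) set, ('k ^ 'n) \<times> ('k ^ 'n)) manifold"
  note F = sphere_map_frame_orbit[OF r]
  have points_M: "points projective_stiefel2 = frame_orbit ` stiefel2"
    by (simp add: projective_stiefel2_def quotient_manifold_def)
  have points_N: "points ?N = frame_velocity r ` stiefel2"
    unfolding tangent_sphere_bundle_def submanifold_def sphere_points[OF r] by simp
  have "diffeomorphism projective_stiefel2 ?N ?F"
  proof (rule diffeomorphism_transported_charts)
    have "inj_on ?F (frame_orbit ` stiefel2)"
    proof (rule inj_onI)
      fix X Y assume "X \<in> frame_orbit ` stiefel2" "Y \<in> frame_orbit ` stiefel2" and eq: "?F X = ?F Y"
      then obtain p q where p: "p \<in> stiefel2" "X = frame_orbit p"
        and q: "q \<in> stiefel2" "Y = frame_orbit q"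
        by blast
      from eq show "X = Y"
        unfolding p(2) q(2) F[OF p(1)] F[OF q(1)] frame_velocity_eq_iff[OF r p(1) q(1)] .
    qed
    moreover have "?F ` frame_orbit ` stiefel2 = frame_velocity r ` stiefel2"
      unfolding image_image by (intro image_cong refl F)
    ultimately show "bij_betw ?F (points projective_stiefel2) (points ?N)"
      by (simp add: bij_betw_def points_M points_N)
  next
    fix x :: "(('k ^ 'n) \<times> ('k ^ 'n)) set"
    assume "x \<in> points projective_stiefel2"
    then obtain p where p: "p \<in> stiefel2" "x = frame_orbit p" by (auto simp: points_M)
    obtain i a where a: "a \<noteq> 0" "a $ i = 0" and dom: "p \<in> frame_domain i a"
      using frame_chart_exists[OF p(1)] by blast
    let ?U = "frame_orbit ` (stiefel2 \<inter> frame_domain i a)"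
    have ch: "(?U, sphere_coord i a \<circ> ?F) \<in> charts projective_stiefel2"
      by (rule stiefel_chart[OF a r])
    then have "inj_on (sphere_coord i a \<circ> ?F) ?U"
      by (simp add: projective_stiefel2_def quotient_manifold_def coordinates_def)
    moreover have "?F ` ?U = frame_velocity r ` (stiefel2 \<inter> frame_domain i a)"
      unfolding image_image by (intro image_cong refl F) simp
    then have "(?F ` ?U, sphere_coord i a) \<in> charts ?N"
      using sphere_chart[OF a r] by simp
    ultimately show "\<exists>U \<psi>. x \<in> U \<and> U \<subseteq> points projective_stiefel2 \<and> inj_on (\<psi> \<circ> ?F) U \<and>
        (U, \<psi> \<circ> ?F) \<in> charts projective_stiefel2 \<and> (?F ` U, \<psi>) \<in> charts ?N"
      using ch p dom
      by (intro exI[of _ ?U] exI[of _ "sphere_coord i a"]) (auto simp: points_M simp del: o_apply)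
  qed
  then show ?thesis
    by (auto simp: natural_diffeomorphism_def F frame_velocity_def)
qed

theorem corollary4p3:
  fixes n :: nat and r :: real
  assumes "CARD('n::finite) = n + 1" and "r > 0"
  shows "(n \<ge> 2 \<longrightarrow>
           (\<exists>F :: ((real ^ 'n) \<times> (real ^ 'n)) set \<Rightarrow> (real \<Rightarrow> (real ^ 'n) set) set.
              natural_diffeomorphism r F)) \<and>
         (n \<ge> 2 \<longrightarrow>
           (\<exists>F :: ((complex ^ 'n) \<times> (complex ^ 'n)) set \<Rightarrow> (real \<Rightarrow> (complex ^ 'n) set) set.
              natural_diffeomorphism r F)) \<and>
         (n \<ge> 1 \<longrightarrow>
           (\<exists>F :: ((quat ^ 'n) \<times> (quat ^ 'n)) set \<Rightarrow> (real \<Rightarrow> (quat ^ 'n) set) set.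
              natural_diffeomorphism r F))"
  \<comment> \<open>The construction is uniform over \<open>conj_div_algebra\<close>, of which
    \<open>real\<close>, \<open>complex\<close> and \<open>quat\<close> are instances.\<close>
  by (intro conjI impI exI) (rule natural_diffeomorphism_sphere_map[OF assms(2)])+

end
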